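(* Let $Q$ be a Markov kernel on a measurable space $(\mathsf Z,\mathcal Z)$ that satisfies the uniform geometric ergodicity assumption (UGE) with invariant distribution $\pi$ and mixing time $\tau$. Let $C_1=60e$, $C_2=60$, $D_1=\tfrac{16}{3}\left(\tfrac{19}{3}\right)^{1/2}C_1$ and $D_2=\tfrac{32}{3}\left(C_2^{1/2}C_1^2+C_2\right)$. Then for every bounded measurable function $f:\mathsf Z\to\mathbb R$, every $p\ge 2$ and every integer $n\ge 1$, $$\mathrm E_\pi^{1/p}\left[|S_n|^p\right]\le C_1\sqrt2\,p^{1/2}n^{1/2}\sigma_\pi(f)+2D_1\,n^{1/4}\tau^{3/4}\,p\log_2(2p)\,\|f\|_\infty+2D_2\,\tau\,p\log_2(2p)\,\|f\|_\infty .$$ Moreover, for every initial probability measure $\xi$ on $(\mathsf Z,\mathcal Z)$, $$\mathrm E_\xi^{1/p}\left[|S_n|^p\right]\le \mathrm E_\pi^{1/p}\left[|S_n|^p\right]+2D_2\,\tau\,p\log_2(2p)\,\|f\|_\infty .$$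
   Context: $(Z_k)_{k\ge0}$ is the (canonical) Markov chain with kernel $Q$; $\mathrm P_\xi,\mathrm E_\xi$ denote probability and expectation when $Z_0\sim\xi$, and $\mathrm E_\xi^{1/p}[\cdot]=(\mathrm E_\xi[\cdot])^{1/p}$. For a signed measure $\mu$, $\|\mu\|_{\mathrm{TV}}=|\mu|(\mathsf Z)$. Assumption (UGE): $Q$ has a unique invariant distribution $\pi$, and there is an integer $\tau\ge1$ such that for all integers $n\ge 0$ and all $z\in\mathsf Z$, $\tfrac12\|Q^n(z,\cdot)-\pi\|_{\mathrm{TV}}\le (1/4)^{\lfloor n/\tau\rfloor}$. For $f$ bounded measurable: $\pi(f)=\int f\,d\pi$, $\bar f=f-\pi(f)$, $\|f\|_\infty=\sup_z|f(z)|$, $S_n=\sum_{\ell=0}^{n-1}\{f(Z_\ell)-\pi(f)\}$, and the asymptotic variance is $\sigma_\pi^2(f)=\pi(\bar f^2)+2\sum_{\ell=1}^\infty\pi(\bar f\,Q^\ell\bar f)$, with $\sigma_\pi(f)=\sqrt{\sigma_\pi^2(f)}$. *)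

theory Defs
  imports "HOL-Probability.Probability"
begin

definition markov_kernel :: "'a measure \<Rightarrow> ('a \<Rightarrow> 'a measure) \<Rightarrow> bool" where
  "markov_kernel M Q \<longleftrightarrow> Q \<in> measurable M (prob_algebra M)"

primrec kernel_pow :: "'a measure \<Rightarrow> ('a \<Rightarrow> 'a measure) \<Rightarrow> nat \<Rightarrow> 'a \<Rightarrow> 'a measure" where
  "kernel_pow M Q 0 z = return M z"
| "kernel_pow M Q (Suc n) z = Q z \<bind> kernel_pow M Q n"

definition kernel_op :: "('a \<Rightarrow> 'a measure) \<Rightarrow> ('a \<Rightarrow> real) \<Rightarrow> 'a \<Rightarrow> real" where
  "kernel_op K g z = (\<integral>y. g y \<partial>K z)"

definition invariant_distribution :: "'a measure \<Rightarrow> ('a \<Rightarrow> 'a measure) \<Rightarrow> 'a measure \<Rightarrow> bool" where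
  "invariant_distribution M Q \<pi> \<longleftrightarrow> \<pi> \<in> space (prob_algebra M) \<and> \<pi> \<bind> Q = \<pi>"

text \<open>
  A signed measure on \<open>M\<close> is represented by its set function \<open>\<mu>\<close>; the value below is
  \<open>|\<mu>|(space M)\<close>, the supremum of \<open>\<Sum>i. |\<mu> (A i)|\<close> over countable measurable partitions \<open>A\<close>
  of the space.
\<close>
definition tv_norm :: "'a measure \<Rightarrow> ('a set \<Rightarrow> real) \<Rightarrow> ennreal" where
  "tv_norm M \<mu> =
     (SUP A \<in> {A :: nat \<Rightarrow> 'a set. range A \<subseteq> sets M \<and> disjoint_family A \<and> (\<Union>i. A i) = space M}.
        \<Sum>i. ennreal \<bar>\<mu> (A i)\<bar>)"

definition UGE :: "'a measure \<Rightarrow> ('a \<Rightarrow> 'a measure) \<Rightarrow> 'a measure \<Rightarrow> nat \<Rightarrow> bool" where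
  "UGE M Q \<pi> \<tau> \<longleftrightarrow>
     invariant_distribution M Q \<pi> \<and>
     (\<forall>\<pi>'. invariant_distribution M Q \<pi>' \<longrightarrow> \<pi>' = \<pi>) \<and>
     \<tau> \<ge> 1 \<and>
     (\<forall>n. \<forall>z\<in>space M.
        1 / 2 * tv_norm M (\<lambda>A. measure (kernel_pow M Q n z) A - measure \<pi> A)
          \<le> ennreal ((1 / 4) ^ (n div \<tau>)))"

text \<open>
  The law \<open>P\<^sub>\<xi>\<close> of the canonical chain on \<open>PiM UNIV (\<lambda>_. M)\<close>: the Ionescu-Tulcea extension of
  the initial law \<open>\<xi>\<close> and the transitions \<open>Q\<close>. The chain itself is the coordinate process
  \<open>\<omega> k\<close>.
\<close>
definition chain_step :: "('a \<Rightarrow> 'a measure) \<Rightarrow> 'a measure \<Rightarrow> nat \<Rightarrow> (nat \<Rightarrow> 'a) \<Rightarrow> 'a measure" where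
  "chain_step Q \<xi> k \<omega> = (case k of 0 \<Rightarrow> \<xi> | Suc i \<Rightarrow> Q (\<omega> i))"

definition chain_law :: "'a measure \<Rightarrow> ('a \<Rightarrow> 'a measure) \<Rightarrow> 'a measure \<Rightarrow> (nat \<Rightarrow> 'a) measure" where
  "chain_law M Q \<xi> =
     projective_family.lim UNIV (Ionescu_Tulcea.CI (chain_step Q \<xi>) (\<lambda>_. M)) (\<lambda>_. M)"

definition centered :: "'a measure \<Rightarrow> ('a \<Rightarrow> real) \<Rightarrow> 'a \<Rightarrow> real" where
  "centered \<pi> f z = f z - (\<integral>y. f y \<partial>\<pi>)"

definition sup_norm :: "'a measure \<Rightarrow> ('a \<Rightarrow> real) \<Rightarrow> real" where
  "sup_norm M f = (SUP z\<in>space M. \<bar>f z\<bar>)"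

definition partial_sum :: "'a measure \<Rightarrow> ('a \<Rightarrow> real) \<Rightarrow> nat \<Rightarrow> (nat \<Rightarrow> 'a) \<Rightarrow> real" where
  "partial_sum \<pi> f n \<omega> = (\<Sum>l<n. f (\<omega> l) - (\<integral>y. f y \<partial>\<pi>))"

definition asym_var :: "'a measure \<Rightarrow> ('a \<Rightarrow> 'a measure) \<Rightarrow> 'a measure \<Rightarrow> ('a \<Rightarrow> real) \<Rightarrow> real" where
  "asym_var M Q \<pi> f =
     (\<integral>z. (centered \<pi> f z)\<^sup>2 \<partial>\<pi>)
     + 2 * (\<Sum>l. \<integral>z. centered \<pi> f z * kernel_op (kernel_pow M Q (Suc l)) (centered \<pi> f) z \<partial>\<pi>)"

definition moment_root :: "'b measure \<Rightarrow> real \<Rightarrow> ('b \<Rightarrow> real) \<Rightarrow> real" where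
  "moment_root P p X = (\<integral>\<omega>. \<bar>X \<omega>\<bar> powr p \<partial>P) powr (1 / p)"

definition C1 :: real where "C1 = 60 * exp 1"
definition C2 :: real where "C2 = 60"
definition D1 :: real where "D1 = 16 / 3 * sqrt (19 / 3) * C1"
definition D2 :: real where "D2 = 32 / 3 * (sqrt C2 * C1\<^sup>2 + C2)"

lemma Ionescu_Tulcea_chain:
  assumes Q: "markov_kernel M Q" and xi: "\<xi> \<in> space (prob_algebra M)"
  shows "Ionescu_Tulcea (chain_step Q \<xi>) (\<lambda>_. M)"
proof (rule Ionescu_Tulcea.intro)
  have Q': "Q \<in> measurable M (subprob_algebra M)"
    using Q unfolding markov_kernel_def by (rule measurable_prob_algebraD)
  have xi': "\<xi> \<in> space (subprob_algebra M)" "prob_space \<xi>"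
    using xi by (auto simp: space_prob_algebra space_subprob_algebra prob_space_imp_subprob_space)
  show "chain_step Q \<xi> i \<in> measurable (Pi\<^sub>M {0..<i} (\<lambda>_. M)) (subprob_algebra M)" for i
  proof (cases i)
    case 0
    then show ?thesis using xi' by (simp add: chain_step_def[abs_def])
  next
    case (Suc j)
    have "(\<lambda>\<omega>. \<omega> j) \<in> measurable (Pi\<^sub>M {0..<i} (\<lambda>_. M)) M"
      using Suc by (intro measurable_component_singleton) auto
    from measurable_compose[OF this Q'] show ?thesis
      using Suc by (simp add: chain_step_def[abs_def])
  qed
  show "prob_space (chain_step Q \<xi> i x)" if "x \<in> space (Pi\<^sub>M {0..<i} (\<lambda>_. M))" for i x
  proof (cases i)
    case 0
    then show ?thesis using xi' by (simp add: chain_step_def)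
  next
    case (Suc j)
    then have "x j \<in> space M" using that by (auto simp: space_PiM PiE_iff)
    then have "Q (x j) \<in> space (prob_algebra M)"
      using Q unfolding markov_kernel_def by (rule measurable_space[rotated])
    then show ?thesis using Suc by (simp add: chain_step_def space_prob_algebra)
  qed
qed

lemma sets_chain_law:
  assumes "markov_kernel M Q" and "\<xi> \<in> space (prob_algebra M)"
  shows "sets (chain_law M Q \<xi>) = sets (PiM UNIV (\<lambda>_. M))"
proof -
  interpret Ionescu_Tulcea "chain_step Q \<xi>" "\<lambda>_. M"
    using assms by (rule Ionescu_Tulcea_chain)
  show ?thesis unfolding chain_law_def by (rule PF.sets_lim)
qed

lemma nn_integral_chain_law:
  assumes Q: "markov_kernel M Q" and xi: "\<xi> \<in> space (prob_algebra M)"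
    and g[measurable]: "g \<in> borel_measurable (PiM {0..<n} (\<lambda>_. M))"
  shows "(\<integral>\<^sup>+\<omega>. g (restrict \<omega> {0..<n}) \<partial>chain_law M Q \<xi>) =
         (\<integral>\<^sup>+\<omega>. g \<omega> \<partial>Ionescu_Tulcea.C (chain_step Q \<xi>) (\<lambda>_. M) 0 n (\<lambda>_. undefined))"
proof -
  interpret Ionescu_Tulcea "chain_step Q \<xi>" "\<lambda>_. M"
    using Q xi by (rule Ionescu_Tulcea_chain)
  have u: "up_to {0..<n} = n"
    by (intro antisym, simp add: up_to_iff_Ico) (metis finite_atLeastLessThan nat_le_linear
        order_refl up_to_iff_Ico atLeastLessThan_subset_iff le_zero_eq le0)
  have un: "(\<lambda>_. undefined) \<in> space (PiM {0..<0::nat} (\<lambda>_. M))"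
    by (simp add: space_PiM PiE_iff extensional_def)
  have "(\<integral>\<^sup>+\<omega>. g (restrict \<omega> {0..<n}) \<partial>PF.lim) =
        (\<integral>\<^sup>+\<omega>. g \<omega> \<partial>distr PF.lim (PiM {0..<n} (\<lambda>_. M)) (\<lambda>x. restrict x {0..<n}))"
    by (rule nn_integral_distr[symmetric])
       (simp_all add: measurable_cong_sets[OF PF.sets_lim refl] measurable_restrict_subset del: restrict_apply)
  also have "\<dots> = (\<integral>\<^sup>+\<omega>. g \<omega> \<partial>CI {0..<n})"
    by (simp add: distr_lim)
  also have "\<dots> = (\<integral>\<^sup>+\<omega>. g (restrict \<omega> {0..<n}) \<partial>C 0 n (\<lambda>_. undefined))"
    unfolding CI_def u
    by (subst nn_integral_distr)
       (simp_all add: measurable_cong_sets[OF sets_C[OF un] refl] measurable_restrict_subset del: restrict_apply)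
  also have "\<dots> = (\<integral>\<^sup>+\<omega>. g \<omega> \<partial>C 0 n (\<lambda>_. undefined))"
    using nn_integral_C[of n n g 0 "\<lambda>_. undefined"] un by simp
  finally show ?thesis unfolding chain_law_def .
qed

lemma chain_law_initial:
  assumes Q: "markov_kernel M Q" and xi: "\<xi> \<in> space (prob_algebra M)"
    and g[measurable]: "g \<in> borel_measurable M"
  shows "(\<integral>\<^sup>+\<omega>. g (\<omega> 0) \<partial>chain_law M Q \<xi>) = (\<integral>\<^sup>+x. g x \<partial>\<xi>)"
proof -
  interpret Ionescu_Tulcea "chain_step Q \<xi>" "\<lambda>_. M"
    using Q xi by (rule Ionescu_Tulcea_chain)
  have un: "(\<lambda>_. undefined) \<in> space (PiM {0..<0::nat} (\<lambda>_. M))"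
    by (simp add: space_PiM PiE_iff extensional_def)
  have m: "(\<lambda>\<omega>. g (\<omega> 0)) \<in> borel_measurable (PiM {0..<Suc 0} (\<lambda>_. M))"
    by (rule measurable_compose[OF _ g]) (rule measurable_component_singleton, simp)
  have "C 0 (Suc 0) (\<lambda>_. undefined) = eP 0 (\<lambda>_. undefined)"
    using bind_return[OF measurable_eP un] by simp
  then show ?thesis
    using nn_integral_chain_law[OF Q xi m] nn_integral_eP[OF un m]
    by (simp add: chain_step_def del: C.simps)
qed

lemma chain_law_markov:
  assumes Q: "markov_kernel M Q" and xi: "\<xi> \<in> space (prob_algebra M)"
    and g[measurable]: "g \<in> borel_measurable (PiM {0..<Suc (Suc n)} (\<lambda>_. M))"
  shows "(\<integral>\<^sup>+\<omega>. g (restrict \<omega> {0..<Suc (Suc n)}) \<partial>chain_law M Q \<xi>) =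
         (\<integral>\<^sup>+\<omega>. (\<integral>\<^sup>+y. g ((restrict \<omega> {0..<Suc n})(Suc n := y)) \<partial>Q (\<omega> n)) \<partial>chain_law M Q \<xi>)"
proof -
  interpret Ionescu_Tulcea "chain_step Q \<xi>" "\<lambda>_. M"
    using Q xi by (rule Ionescu_Tulcea_chain)
  have un: "(\<lambda>_. undefined) \<in> space (PiM {0..<0::nat} (\<lambda>_. M))"
    by (simp add: space_PiM PiE_iff extensional_def)
  let ?h = "\<lambda>\<omega>. \<integral>\<^sup>+x. g x \<partial>eP (Suc n) \<omega>"
  have h: "?h \<in> borel_measurable (PiM {0..<Suc n} (\<lambda>_. M))"
    by measurable
  have "(\<integral>\<^sup>+\<omega>. g (restrict \<omega> {0..<Suc (Suc n)}) \<partial>chain_law M Q \<xi>) =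
        (\<integral>\<^sup>+\<omega>. g \<omega> \<partial>C 0 (Suc (Suc n)) (\<lambda>_. undefined))"
    by (rule nn_integral_chain_law[OF Q xi g])
  also have "\<dots> = (\<integral>\<^sup>+\<omega>. ?h \<omega> \<partial>C 0 (Suc n) (\<lambda>_. undefined))"
    unfolding C.simps(2)[of 0 "Suc n"] add_0
    by (rule nn_integral_bind[OF g])
       (use measurable_eP[of "Suc n"] in \<open>simp add: measurable_cong_sets[OF sets_C[OF un] refl] del: C.simps\<close>)
  also have "\<dots> = (\<integral>\<^sup>+\<omega>. ?h (restrict \<omega> {0..<Suc n}) \<partial>chain_law M Q \<xi>)"
    by (rule nn_integral_chain_law[OF Q xi h, symmetric])
  also have "\<dots> = (\<integral>\<^sup>+\<omega>. (\<integral>\<^sup>+y. g ((restrict \<omega> {0..<Suc n})(Suc n := y)) \<partial>Q (\<omega> n)) \<partial>chain_law M Q \<xi>)"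
  proof (rule nn_integral_cong)
    fix \<omega> assume "\<omega> \<in> space (chain_law M Q \<xi>)"
    then have "\<omega> \<in> space (PiM UNIV (\<lambda>_. M))"
      using sets_eq_imp_space_eq[OF sets_chain_law[OF Q xi]] by simp
    then have "restrict \<omega> {0..<Suc n} \<in> space (PiM {0..<Suc n} (\<lambda>_. M))"
      by (auto simp: space_PiM PiE_iff)
    from nn_integral_eP[OF this g]
    show "?h (restrict \<omega> {0..<Suc n}) = (\<integral>\<^sup>+y. g ((restrict \<omega> {0..<Suc n})(Suc n := y)) \<partial>Q (\<omega> n))"
      by (simp add: chain_step_def)
  qed
  finally show ?thesis .
qed

end

theory Submission
  imports Defs
begin

text \<open>
  Both bounds rest on exponential moments and on the semigroup of the pair \<open>(Z\<^sub>n, S\<^sub>n)\<close>; no martingale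
  moment inequality is used.

  Let \<open>F = f - \<pi>(f)\<close> and let \<open>g = \<Sum>\<^sub>k Q\<^sup>k F\<close> solve the Poisson equation. The chain is cut into blocks of
  length \<open>\<tau>\<close>. Over one block the martingale part \<open>D = S\<^sub>\<tau> + g(Z\<^sub>\<tau>) - g(Z\<^sub>0)\<close> is bounded by \<open>b\<close>, a multiple of
  \<open>\<tau> \<parallel>f\<parallel>\<close>, and its conditional variance \<open>H(z) = E\<^sub>z[D\<^sup>2]\<close> has mean \<open>\<tau> \<sigma>\<^sub>\<pi>\<^sup>2(f)\<close>. Let \<open>G\<close> solve the Poisson
  equation of \<open>Q\<^sup>\<tau>\<close> for \<open>H\<close>; it is of order \<open>b\<^sup>2\<close>. Adding the corrector \<open>2 \<theta>\<^sup>2 G\<close> to the exponent \<open>\<theta> (S + g)\<close>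
  replaces \<open>H\<close> by its mean in the second-order expansion of the exponential, at the price of an error
  of order \<open>\<theta>\<^sup>4 b\<^sup>4\<close> per block. Hence \<open>E exp(\<theta> S\<^sub>n)\<close> is at most
  \<open>exp(1 + 2 \<theta>\<^sup>2 n \<sigma>\<^sub>\<pi>\<^sup>2(f) + 57 \<theta>\<^sup>4 b\<^sup>4 n / \<tau>)\<close> for \<open>|\<theta>| b \<le> 1/4\<close>, and the moment bound follows by optimising \<open>\<theta>\<close>.

  For the change of initial law, let \<open>w(z)\<close> be the \<open>L\<^sup>p\<close> norm of \<open>S\<^sub>n\<close> started at \<open>z\<close>. Skipping the first
  \<open>m = k \<tau>\<close> steps changes \<open>w(z)\<close> by \<open>O(m \<parallel>f\<parallel>)\<close>, and after \<open>m\<close> steps with \<open>k\<close> of order \<open>p\<close> mixing has halved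
  the oscillation. So the oscillation of \<open>w\<close> is itself \<open>O(p \<tau> \<parallel>f\<parallel>)\<close>.
\<close>

subsection \<open>Kernels and total variation\<close>

lemma prob_algebraD:
  assumes "\<mu> \<in> space (prob_algebra M)"
  shows "prob_space \<mu>" "sets \<mu> = sets M" "space \<mu> = space M"
  using assms by (auto simp: space_prob_algebra dest: sets_eq_imp_space_eq)

lemma integrable_prob_algebra_bounded:
  fixes u :: "'a \<Rightarrow> real"
  assumes \<mu>: "\<mu> \<in> space (prob_algebra M)" and u: "u \<in> borel_measurable M"
    and bound: "\<And>x. x \<in> space M \<Longrightarrow> \<bar>u x\<bar> \<le> C"
  shows "integrable \<mu> u"
proof -
  interpret prob_space \<mu> using prob_algebraD[OF \<mu>] by simp
  show ?thesis
    using u bound prob_algebraD[OF \<mu>]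
    by (intro integrable_const_bound[where B = C] AE_I2) (auto cong: measurable_cong_sets)
qed

lemma integral_prob_algebra_bounds:
  fixes u :: "'a \<Rightarrow> real"
  assumes \<mu>: "\<mu> \<in> space (prob_algebra M)" and u: "u \<in> borel_measurable M"
    and bound: "\<And>x. x \<in> space M \<Longrightarrow> a \<le> u x" "\<And>x. x \<in> space M \<Longrightarrow> u x \<le> b"
  shows "a \<le> (\<integral>x. u x \<partial>\<mu>)" "(\<integral>x. u x \<partial>\<mu>) \<le> b"
proof -
  interpret prob_space \<mu> using prob_algebraD[OF \<mu>] by simp
  have int: "integrable \<mu> u"
    using bound by (intro integrable_prob_algebra_bounded[OF \<mu> u, of "max \<bar>a\<bar> \<bar>b\<bar>"]) fastforce
  show "a \<le> (\<integral>x. u x \<partial>\<mu>)" "(\<integral>x. u x \<partial>\<mu>) \<le> b"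
    using bound prob_algebraD[OF \<mu>]
    by (auto intro!: integral_ge_const[OF int] integral_le_const[OF int] AE_I2)
qed

lemma integral_prob_algebra_abs_le:
  fixes u :: "'a \<Rightarrow> real"
  assumes "\<mu> \<in> space (prob_algebra M)" and "u \<in> borel_measurable M"
    and "\<And>x. x \<in> space M \<Longrightarrow> \<bar>u x\<bar> \<le> C"
  shows "\<bar>\<integral>x. u x \<partial>\<mu>\<bar> \<le> C"
proof -
  have "- C \<le> u x" "u x \<le> C" if "x \<in> space M" for x
    using assms(3)[OF that] by auto
  from integral_prob_algebra_bounds[OF assms(1,2), of "- C" C, OF this] show ?thesis by auto
qed

text \<open>Facts about the chain law come as identities of nonnegative integrals. Adding a bound
  \<open>C\<close> brings a bounded real function into their range, and on probability spaces
  \<open>C\<close> can be subtracted again.\<close>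

lemma integral_eq_of_nn_integral_eq:
  fixes u :: "'a \<Rightarrow> real" and v :: "'b \<Rightarrow> real"
  assumes "prob_space P" "prob_space R"
    and [measurable]: "u \<in> borel_measurable P" "v \<in> borel_measurable R"
    and u: "\<And>x. x \<in> space P \<Longrightarrow> \<bar>u x\<bar> \<le> C" and v: "\<And>x. x \<in> space R \<Longrightarrow> \<bar>v x\<bar> \<le> C"
    and eq: "(\<integral>\<^sup>+x. ennreal (u x + C) \<partial>P) = (\<integral>\<^sup>+x. ennreal (v x + C) \<partial>R)"
  shows "(\<integral>x. u x \<partial>P) = (\<integral>x. v x \<partial>R)"
proof -
  interpret P: prob_space P by fact
  interpret R: prob_space R by fact
  have iu: "integrable P u" using u by (intro P.integrable_const_bound[where B = C] AE_I2) auto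
  have iv: "integrable R v" using v by (intro R.integrable_const_bound[where B = C] AE_I2) auto
  have nn: "0 \<le> u x + C" if "x \<in> space P" for x using u[OF that] by auto
  have nn': "0 \<le> v x + C" if "x \<in> space R" for x using v[OF that] by auto
  have "(\<integral>x. u x + C \<partial>P) = enn2real (\<integral>\<^sup>+x. ennreal (u x + C) \<partial>P)"
    by (rule integral_eq_nn_integral) (auto intro: AE_I2 nn)
  moreover have "(\<integral>x. v x + C \<partial>R) = enn2real (\<integral>\<^sup>+x. ennreal (v x + C) \<partial>R)"
    by (rule integral_eq_nn_integral) (auto intro: AE_I2 nn')
  ultimately have "(\<integral>x. u x + C \<partial>P) = (\<integral>x. v x + C \<partial>R)" using eq by simp
  then show ?thesis using iu iv by (simp add: P.prob_space R.prob_space)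
qed

lemma measurable_kernel_integral:
  fixes u :: "'b \<Rightarrow> real"
  assumes K: "K \<in> measurable M (prob_algebra N)" and u: "u \<in> borel_measurable N"
  shows "(\<lambda>x. \<integral>y. u y \<partial>K x) \<in> borel_measurable M"
  using measurable_compose[OF measurable_prob_algebraD[OF K] integral_measurable_subprob_algebra[OF u]] .

lemma integral_bind_bounded:
  fixes u :: "'b \<Rightarrow> real"
  assumes \<mu>: "\<mu> \<in> space (prob_algebra M)" and K: "K \<in> measurable M (prob_algebra N)"
    and u[measurable]: "u \<in> borel_measurable N" and bound: "\<And>x. x \<in> space N \<Longrightarrow> \<bar>u x\<bar> \<le> C"
  shows "(\<integral>y. u y \<partial>(\<mu> \<bind> K)) = (\<integral>x. (\<integral>y. u y \<partial>K x) \<partial>\<mu>)"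
proof (rule integral_eq_of_nn_integral_eq[where C = C])
  note \<mu>' = prob_algebraD[OF \<mu>]
  have K\<mu>: "K \<in> measurable \<mu> (prob_algebra N)"
    using K \<mu>' by (simp cong: measurable_cong_sets)
  have Kx: "K x \<in> space (prob_algebra N)" if "x \<in> space M" for x
    using measurable_space[OF K that] .
  have bK: "\<bar>\<integral>y. u y \<partial>K x\<bar> \<le> C" if "x \<in> space M" for x
    by (rule integral_prob_algebra_abs_le[OF Kx[OF that] u bound])
  show "prob_space (\<mu> \<bind> K)" "prob_space \<mu>" using prob_space_bind'[OF \<mu> K] \<mu>' by auto
  have sb: "sets (\<mu> \<bind> K) = sets N" by (rule sets_bind'[OF \<mu> K])
  then show "u \<in> borel_measurable (\<mu> \<bind> K)" by (simp cong: measurable_cong_sets)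
  show "(\<lambda>x. \<integral>y. u y \<partial>K x) \<in> borel_measurable \<mu>"
    by (rule measurable_kernel_integral[OF K\<mu> u])
  show "\<bar>u x\<bar> \<le> C" if "x \<in> space (\<mu> \<bind> K)" for x
    using bound that sets_eq_imp_space_eq[OF sb] by simp
  show "\<bar>\<integral>y. u y \<partial>K x\<bar> \<le> C" if "x \<in> space \<mu>" for x using bK that \<mu>' by simp
  have "(\<integral>\<^sup>+y. ennreal (u y + C) \<partial>(\<mu> \<bind> K)) = (\<integral>\<^sup>+x. (\<integral>\<^sup>+y. ennreal (u y + C) \<partial>K x) \<partial>\<mu>)"
    by (rule nn_integral_bind[OF _ measurable_prob_algebraD[OF K\<mu>]]) measurable
  also have "\<dots> = (\<integral>\<^sup>+x. ennreal ((\<integral>y. u y \<partial>K x) + C) \<partial>\<mu>)"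
  proof (rule nn_integral_cong)
    fix x assume "x \<in> space \<mu>"
    then have x: "x \<in> space M" using \<mu>' by simp
    interpret Kx: prob_space "K x" using prob_algebraD[OF Kx[OF x]] by simp
    have i: "integrable (K x) u" by (rule integrable_prob_algebra_bounded[OF Kx[OF x] u bound])
    have "0 \<le> u y + C" if "y \<in> space (K x)" for y
      using bound[of y] that prob_algebraD[OF Kx[OF x]] by auto
    then have "(\<integral>\<^sup>+y. ennreal (u y + C) \<partial>K x) = ennreal (\<integral>y. u y + C \<partial>K x)"
      using i by (intro nn_integral_eq_integral) (auto intro: AE_I2)
    then show "(\<integral>\<^sup>+y. ennreal (u y + C) \<partial>K x) = ennreal ((\<integral>y. u y \<partial>K x) + C)"
      using i by (simp add: Kx.prob_space)
  qed
  finally show "(\<integral>\<^sup>+y. ennreal (u y + C) \<partial>(\<mu> \<bind> K)) = (\<integral>\<^sup>+x. ennreal ((\<integral>y. u y \<partial>K x) + C) \<partial>\<mu>)" .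
qed

lemma measurable_kernel_pow:
  assumes Q: "markov_kernel M Q"
  shows "kernel_pow M Q n \<in> measurable M (prob_algebra M)"
proof (induction n)
  case 0
  have "kernel_pow M Q 0 = return M" by (simp add: fun_eq_iff)
  then show ?case by simp
next
  case (Suc n)
  have "kernel_pow M Q (Suc n) = (\<lambda>z. Q z \<bind> kernel_pow M Q n)" by (simp add: fun_eq_iff)
  then show ?case
    using measurable_bind_prob_space[OF Q[unfolded markov_kernel_def] Suc] by simp
qed

text \<open>Chapman-Kolmogorov. The induction is on the first exponent because
  \<open>kernel_pow\<close> puts the single step \<open>Q\<close> first; associativity of bind does
  the rest.\<close>

lemma kernel_pow_add:
  assumes Q: "markov_kernel M Q" and z: "z \<in> space M"
  shows "kernel_pow M Q (m + n) z = kernel_pow M Q m z \<bind> kernel_pow M Q n"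
  using z
proof (induction m arbitrary: z)
  case 0
  then show ?case
    using bind_return[OF measurable_prob_algebraD[OF measurable_kernel_pow[OF Q]], of z n] by simp
next
  case (Suc m)
  have Qz: "Q z \<in> space (prob_algebra M)"
    using measurable_space Q Suc.prems unfolding markov_kernel_def by metis
  have "kernel_pow M Q (Suc m + n) z = Q z \<bind> kernel_pow M Q (m + n)" by simp
  also have "\<dots> = Q z \<bind> (\<lambda>y. kernel_pow M Q m y \<bind> kernel_pow M Q n)"
    using prob_algebraD(3)[OF Qz] Suc.IH by (intro bind_cong) auto
  also have "\<dots> = (Q z \<bind> kernel_pow M Q m) \<bind> kernel_pow M Q n"
  proof (rule bind_assoc[symmetric])
    show "kernel_pow M Q m \<in> measurable (Q z) (subprob_algebra M)"
      using measurable_prob_algebraD[OF measurable_kernel_pow[OF Q]] prob_algebraD(2)[OF Qz]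
      by (simp cong: measurable_cong_sets)
    show "kernel_pow M Q n \<in> measurable M (subprob_algebra M)"
      by (rule measurable_prob_algebraD[OF measurable_kernel_pow[OF Q]])
  qed
  finally show ?case by simp
qed

section \<open>From total variation to differences of integrals\<close>

lemma tv_norm_two_set:
  assumes A: "A \<in> sets M"
  shows "ennreal \<bar>\<mu> A\<bar> + ennreal \<bar>\<mu> (space M - A)\<bar> \<le> tv_norm M \<mu>"
proof -
  define P :: "nat \<Rightarrow> 'a set" where "P i = (if i = 0 then A else if i = 1 then space M - A else {})" for i
  have "P \<in> {A. range A \<subseteq> sets M \<and> disjoint_family A \<and> (\<Union>i. A i) = space M}"
  proof -
    have "range P \<subseteq> sets M" using A by (auto simp: P_def)
    moreover have "disjoint_family P" by (auto simp: P_def disjoint_family_on_def)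
    moreover have "(\<Union>i. P i) = space M"
    proof
      show "space M \<subseteq> (\<Union>i. P i)"
      proof
        fix x assume "x \<in> space M"
        then have "x \<in> P 0 \<or> x \<in> P 1" by (auto simp: P_def)
        then show "x \<in> (\<Union>i. P i)" by blast
      qed
    qed (use A[THEN sets.sets_into_space] in \<open>auto simp: P_def split: if_splits\<close>)
    ultimately show ?thesis by simp
  qed
  then have "(\<Sum>i. ennreal \<bar>\<mu> (P i)\<bar>) \<le> tv_norm M \<mu>"
    unfolding tv_norm_def by (rule SUP_upper)
  moreover have "(\<Sum>i<2. ennreal \<bar>\<mu> (P i)\<bar>) \<le> (\<Sum>i. ennreal \<bar>\<mu> (P i)\<bar>)"
    by (rule sum_le_suminf) auto
  ultimately show ?thesis by (simp add: P_def numeral_2_eq_2 lessThan_Suc add.commute)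
qed

text \<open>Two probability measures differ on the complement of \<open>A\<close> by as much as on
  \<open>A\<close>. The two-set partition counts the difference twice, which cancels the factor
  1/2.\<close>

lemma measure_diff_le_half_tv:
  assumes \<mu>: "\<mu> \<in> space (prob_algebra M)" and \<nu>: "\<nu> \<in> space (prob_algebra M)"
    and tv: "1 / 2 * tv_norm M (\<lambda>A. measure \<mu> A - measure \<nu> A) \<le> ennreal t" and t: "0 \<le> t"
    and A: "A \<in> sets M"
  shows "\<bar>measure \<mu> A - measure \<nu> A\<bar> \<le> t"
proof -
  interpret \<mu>: prob_space \<mu> using prob_algebraD[OF \<mu>] by simp
  interpret \<nu>: prob_space \<nu> using prob_algebraD[OF \<nu>] by simp
  let ?d = "\<bar>measure \<mu> A - measure \<nu> A\<bar>"
  have "measure \<mu> (space M - A) = 1 - measure \<mu> A" "measure \<nu> (space M - A) = 1 - measure \<nu> A"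
    using \<mu>.prob_compl[of A] \<nu>.prob_compl[of A] A prob_algebraD[OF \<mu>] prob_algebraD[OF \<nu>] by auto
  then have "\<bar>measure \<mu> (space M - A) - measure \<nu> (space M - A)\<bar> = ?d" by simp
  then have "ennreal ?d + ennreal ?d \<le> tv_norm M (\<lambda>A. measure \<mu> A - measure \<nu> A)"
    using tv_norm_two_set[OF A, of "\<lambda>A. measure \<mu> A - measure \<nu> A"] by simp
  then have "1 / 2 * (ennreal ?d + ennreal ?d) \<le> ennreal t"
    using tv by (meson mult_left_mono order_trans zero_le)
  also have "1 / 2 * (ennreal ?d + ennreal ?d) = ennreal (1 / 2 * (?d + ?d))"
  proof -
    have "(1 / 2 :: ennreal) = ennreal (1 / 2)"
      using divide_ennreal[of 1 2] by simp
    moreover have "ennreal ?d + ennreal ?d = ennreal (?d + ?d)"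
      by (rule ennreal_plus[symmetric]) auto
    ultimately show ?thesis by (simp only: ennreal_mult'[symmetric] zero_le_divide_iff)
        (subst ennreal_mult, auto)
  qed
  finally have "1 / 2 * (?d + ?d) \<le> t" using t by (subst (asm) ennreal_le_iff) auto
  then show ?thesis by simp
qed

text \<open>Layer cake formula: \<open>u x\<close> is the length of the interval
  \<open>{0..<u x}\<close>, and Fubini exchanges levels and points.\<close>

lemma nn_integral_layer_cake_unit:
  fixes u :: "'a \<Rightarrow> real"
  assumes \<mu>: "\<mu> \<in> space (prob_algebra M)" and u: "u \<in> borel_measurable M"
    and bound: "\<And>x. x \<in> space M \<Longrightarrow> 0 \<le> u x" "\<And>x. x \<in> space M \<Longrightarrow> u x \<le> 1"
  shows "(\<integral>\<^sup>+x. ennreal (u x) \<partial>\<mu>) =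
    (\<integral>\<^sup>+s. ennreal (measure \<mu> {x \<in> space M. s < u x}) * indicator {0..1} s \<partial>lborel)"
proof -
  note \<mu>' = prob_algebraD[OF \<mu>]
  interpret \<mu>: prob_space \<mu> using \<mu>' by simp
  interpret pair_sigma_finite \<mu> lborel ..
  have u'[measurable]: "u \<in> borel_measurable \<mu>" using u \<mu>' by (simp cong: measurable_cong_sets)
  have "(\<integral>\<^sup>+x. ennreal (u x) \<partial>\<mu>) = (\<integral>\<^sup>+x. (\<integral>\<^sup>+s. indicator {0..<u x} s \<partial>lborel) \<partial>\<mu>)"
    using bound \<mu>' by (intro nn_integral_cong) auto
  also have "\<dots> = (\<integral>\<^sup>+x. (\<integral>\<^sup>+s. (if 0 \<le> s \<and> s < u x then 1 else 0) \<partial>lborel) \<partial>\<mu>)"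
    by (intro nn_integral_cong) (auto simp: indicator_def)
  also have "\<dots> = (\<integral>\<^sup>+s. (\<integral>\<^sup>+x. (if 0 \<le> s \<and> s < u x then 1 else 0) \<partial>\<mu>) \<partial>lborel)"
    by (rule Fubini'[symmetric]) (simp add: split_beta')
  also have "\<dots> = (\<integral>\<^sup>+s. ennreal (measure \<mu> {x \<in> space M. s < u x}) * indicator {0..1} s \<partial>lborel)"
  proof (rule nn_integral_cong)
    fix s :: real
    have m: "{x \<in> space M. s < u x} \<in> sets \<mu>" using u \<mu>' by auto
    have "(\<integral>\<^sup>+x. (if 0 \<le> s \<and> s < u x then 1 else 0) \<partial>\<mu>) =
      (\<integral>\<^sup>+x. indicator {0..1} s * indicator {x \<in> space M. s < u x} x \<partial>\<mu>)"
      using bound \<mu>' by (intro nn_integral_cong) (fastforce simp: indicator_def)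
    also have "\<dots> = indicator {0..1} s * emeasure \<mu> {x \<in> space M. s < u x}"
      using m by (subst nn_integral_cmult) auto
    finally show "(\<integral>\<^sup>+x. (if 0 \<le> s \<and> s < u x then 1 else 0) \<partial>\<mu>) =
      ennreal (measure \<mu> {x \<in> space M. s < u x}) * indicator {0..1} s"
      by (simp add: \<mu>.emeasure_eq_measure mult.commute)
  qed
  finally show ?thesis .
qed

text \<open>Rescaled to [0,1], the integrand is an average over levels of its superlevel sets, and
  each set costs at most \<open>t\<close>. The constant is the oscillation \<open>b - a\<close>, not
  a multiple of the supremum; \<open>V_oscillation\<close> depends on this.\<close>

lemma integral_diff_le_measure_diff:
  fixes u :: "'a \<Rightarrow> real"
  assumes \<mu>: "\<mu> \<in> space (prob_algebra M)" and \<nu>: "\<nu> \<in> space (prob_algebra M)"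
    and close: "\<And>A. A \<in> sets M \<Longrightarrow> \<bar>measure \<mu> A - measure \<nu> A\<bar> \<le> t"
    and u[measurable]: "u \<in> borel_measurable M"
    and bound: "\<And>x. x \<in> space M \<Longrightarrow> a \<le> u x" "\<And>x. x \<in> space M \<Longrightarrow> u x \<le> b"
  shows "(\<integral>x. u x \<partial>\<mu>) \<le> (\<integral>x. u x \<partial>\<nu>) + (b - a) * t"
proof -
  note \<mu>' = prob_algebraD[OF \<mu>] and \<nu>' = prob_algebraD[OF \<nu>]
  interpret \<mu>: prob_space \<mu> using \<mu>' by simp
  interpret \<nu>: prob_space \<nu> using \<nu>' by simp
  have t: "0 \<le> t" using close[of "space M"] by auto
  have ab: "a \<le> b" using bound \<mu>.not_empty \<mu>' by (metis all_not_in_conv order_trans)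
  \<comment> \<open>The rescaling divides by \<open>b - a\<close>, so a constant integrand is
    settled first.\<close>
  show ?thesis
  proof (cases "a = b")
    case True
    then have "u x = b" if "x \<in> space M" for x using bound that by (meson antisym)
    then have "(\<integral>x. u x \<partial>\<mu>) = (\<integral>x. b \<partial>\<mu>)" "(\<integral>x. u x \<partial>\<nu>) = (\<integral>x. b \<partial>\<nu>)"
      using \<mu>'(3) \<nu>'(3) Bochner_Integration.integral_cong[OF refl, of \<mu> u "\<lambda>_. b"]
        Bochner_Integration.integral_cong[OF refl, of \<nu> u "\<lambda>_. b"] by simp_all
    then show ?thesis using True by (simp add: \<mu>.prob_space \<nu>.prob_space)
  next
    case False
    then have d: "0 < b - a" using ab by simp
    define w where "w x = (u x - a) / (b - a)" for x
    have w[measurable]: "w \<in> borel_measurable M" unfolding w_def by measurable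
    have wb: "0 \<le> w x" "w x \<le> 1" if "x \<in> space M" for x
      using bound[OF that] d by (auto simp: w_def)
    have iw: "integrable \<mu> w" "integrable \<nu> w"
      using wb by (auto intro!: integrable_prob_algebra_bounded[OF \<mu> w, of 1]
          integrable_prob_algebra_bounded[OF \<nu> w, of 1])
    have lc: "(\<integral>\<^sup>+x. ennreal (w x) \<partial>\<rho>) =
      (\<integral>\<^sup>+s. ennreal (measure \<rho> {x \<in> space M. s < w x}) * indicator {0..1} s \<partial>lborel)"
      if "\<rho> \<in> space (prob_algebra M)" for \<rho>
      by (rule nn_integral_layer_cake_unit[OF that w wb])
    have "(\<integral>\<^sup>+x. ennreal (w x) \<partial>\<mu>) \<le>
      (\<integral>\<^sup>+s. ennreal (measure \<nu> {x \<in> space M. s < w x}) * indicator {0..1} s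
         + ennreal t * indicator {0..1} s \<partial>lborel)"
      unfolding lc[OF \<mu>]
    proof (rule nn_integral_mono)
      fix s :: real
      have "measure \<mu> {x \<in> space M. s < w x} \<le> measure \<nu> {x \<in> space M. s < w x} + t"
        using close[of "{x \<in> space M. s < w x}"] by auto
      then show "ennreal (measure \<mu> {x \<in> space M. s < w x}) * indicator {0..1} s \<le>
        ennreal (measure \<nu> {x \<in> space M. s < w x}) * indicator {0..1} s + ennreal t * indicator {0..1} s"
        using t by (auto simp: indicator_def simp flip: ennreal_plus)
    qed
    also have "\<dots> = (\<integral>\<^sup>+x. ennreal (w x) \<partial>\<nu>) + ennreal t"
    proof -
      \<comment> \<open>Superlevel sets shrink as \<open>s\<close> grows, so the function is
        antitone and therefore Borel.\<close>
      have m: "(\<lambda>s. measure \<nu> {x \<in> space M. s < w x}) \<in> borel_measurable borel"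
      proof -
        have "mono (\<lambda>s. - measure \<nu> {x \<in> space M. s < w x})"
          using \<nu>' by (auto intro!: monoI \<nu>.finite_measure_mono)
        from borel_measurable_mono[OF this]
        have "(\<lambda>s. - (- measure \<nu> {x \<in> space M. s < w x})) \<in> borel_measurable borel"
          by (rule borel_measurable_uminus)
        then show ?thesis by simp
      qed
      show ?thesis
        unfolding lc[OF \<nu>]
        using m by (subst nn_integral_add) (auto simp: nn_integral_cmult)
    qed
    finally have "ennreal (\<integral>x. w x \<partial>\<mu>) \<le> ennreal (\<integral>x. w x \<partial>\<nu>) + ennreal t"
      using iw wb \<mu>' \<nu>' by (subst (asm) (1 2) nn_integral_eq_integral) (auto intro!: AE_I2)
    moreover have "0 \<le> (\<integral>x. w x \<partial>\<nu>)" using integral_prob_algebra_bounds[OF \<nu> w wb] by simp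
    ultimately have le: "(\<integral>x. w x \<partial>\<mu>) \<le> (\<integral>x. w x \<partial>\<nu>) + t"
      using t by (simp flip: ennreal_plus)
    have uw: "u x = a + (b - a) * w x" for x using d by (simp add: w_def)
    have "(\<integral>x. u x \<partial>\<mu>) = a + (b - a) * (\<integral>x. w x \<partial>\<mu>)" "(\<integral>x. u x \<partial>\<nu>) = a + (b - a) * (\<integral>x. w x \<partial>\<nu>)"
      unfolding uw using iw by (simp_all add: \<mu>.prob_space \<nu>.prob_space)
    then show ?thesis using mult_left_mono[OF le, of "b - a"] d by (simp add: algebra_simps)
  qed
qed

lemma integral_abs_diff_le_measure_diff:
  fixes u :: "'a \<Rightarrow> real"
  assumes \<mu>: "\<mu> \<in> space (prob_algebra M)" and \<nu>: "\<nu> \<in> space (prob_algebra M)"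
    and close: "\<And>A. A \<in> sets M \<Longrightarrow> \<bar>measure \<mu> A - measure \<nu> A\<bar> \<le> t"
    and u: "u \<in> borel_measurable M"
    and bound: "\<And>x. x \<in> space M \<Longrightarrow> a \<le> u x" "\<And>x. x \<in> space M \<Longrightarrow> u x \<le> b"
  shows "\<bar>(\<integral>x. u x \<partial>\<mu>) - (\<integral>x. u x \<partial>\<nu>)\<bar> \<le> (b - a) * t"
proof -
  have close': "\<bar>measure \<nu> A - measure \<mu> A\<bar> \<le> t" if "A \<in> sets M" for A
    using close[OF that] by (simp add: abs_minus_commute)
  show ?thesis
    using integral_diff_le_measure_diff[OF \<mu> \<nu> close u bound]
      integral_diff_le_measure_diff[OF \<nu> \<mu> close' u bound] by simp
qed

subsection \<open>The chain together with its additive functional\<close>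

text \<open>In the application \<open>F\<close> is \<open>centered \<pi> f\<close> and
  \<open>c\<close> is \<open>2 * sup_norm M f\<close>. Invariance and centring enter only with
  \<open>ergodic_functional\<close>.\<close>

locale additive_functional =
  fixes M :: "'a measure" and Q :: "'a \<Rightarrow> 'a measure" and F :: "'a \<Rightarrow> real" and c :: real
  assumes kernel: "markov_kernel M Q"
    and F_meas[measurable]: "F \<in> borel_measurable M"
    and F_bound: "\<And>z. z \<in> space M \<Longrightarrow> \<bar>F z\<bar> \<le> c"
    and c_nonneg: "0 \<le> c"
begin

definition S :: "nat \<Rightarrow> (nat \<Rightarrow> 'a) \<Rightarrow> real" where
  "S n \<omega> = (\<Sum>l<n. F (\<omega> l))"

abbreviation law :: "'a measure \<Rightarrow> (nat \<Rightarrow> 'a) measure" where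
  "law \<equiv> chain_law M Q"

abbreviation law_from :: "'a \<Rightarrow> (nat \<Rightarrow> 'a) measure" where
  "law_from z \<equiv> law (return M z)"

lemma S_simps[simp]: "S 0 \<omega> = 0" "S (Suc n) \<omega> = S n \<omega> + F (\<omega> n)"
  by (simp_all add: S_def)

lemma Q_meas[measurable]: "Q \<in> measurable M (prob_algebra M)"
  using kernel by (simp add: markov_kernel_def)

lemma Q_meas_subprob[measurable]: "Q \<in> measurable M (subprob_algebra M)"
  by (rule measurable_prob_algebraD) measurable

lemma Q_in: "z \<in> space M \<Longrightarrow> Q z \<in> space (prob_algebra M)"
  by (rule measurable_space[OF Q_meas])

lemma return_in: "z \<in> space M \<Longrightarrow> return M z \<in> space (prob_algebra M)"
  by (simp add: space_prob_algebra prob_space_return)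

lemma kernel_pow_in: "z \<in> space M \<Longrightarrow> kernel_pow M Q n z \<in> space (prob_algebra M)"
  by (rule measurable_space[OF measurable_kernel_pow[OF kernel]])

context
  fixes \<xi> assumes \<xi>: "\<xi> \<in> space (prob_algebra M)"
begin

lemma sets_law[measurable_cong]: "sets (law \<xi>) = sets (PiM UNIV (\<lambda>_. M))"
  by (rule sets_chain_law[OF kernel \<xi>])

lemma space_law: "space (law \<xi>) = UNIV \<rightarrow> space M"
  using sets_eq_imp_space_eq[OF sets_law] by (simp add: space_PiM PiE_UNIV_domain)

lemma law_component[simp]: "\<omega> \<in> space (law \<xi>) \<Longrightarrow> \<omega> i \<in> space M"
  by (auto simp: space_law)

lemma law_component_measurable[measurable]: "(\<lambda>\<omega>. \<omega> i) \<in> measurable (law \<xi>) M"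
  by (subst measurable_cong_sets[OF sets_law refl]) (rule measurable_component_singleton, simp)

lemma law_S_measurable[measurable]: "S n \<in> borel_measurable (law \<xi>)"
  unfolding S_def by measurable

lemma prob_space_law: "prob_space (law \<xi>)"
proof
  interpret \<xi>: prob_space \<xi> using prob_algebraD[OF \<xi>] by simp
  have "emeasure (law \<xi>) (space (law \<xi>)) = (\<integral>\<^sup>+\<omega>. (\<lambda>_. 1) (\<omega> (0::nat)) \<partial>law \<xi>)" by simp
  also have "\<dots> = (\<integral>\<^sup>+z. 1 \<partial>\<xi>)"
    by (rule chain_law_initial[OF kernel \<xi>]) simp
  finally show "emeasure (law \<xi>) (space (law \<xi>)) = 1" by (simp add: \<xi>.emeasure_space_1)
qed

lemma S_diff_bound:
  assumes \<omega>: "\<omega> \<in> space (law \<xi>)"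
  shows "\<bar>S (n + m) \<omega> - S n \<omega>\<bar> \<le> real m * c"
proof (induction m)
  case (Suc m)
  have "\<bar>F (\<omega> (n + m))\<bar> \<le> c" using \<omega> by (intro F_bound) simp
  with Suc show ?case by (simp add: algebra_simps)
qed simp

lemma S_bound:
  assumes \<omega>: "\<omega> \<in> space (law \<xi>)"
  shows "\<bar>S n \<omega>\<bar> \<le> real n * c"
  using S_diff_bound[OF assms, of 0 n] by simp

text \<open>\<open>S n\<close> reads only the coordinates below \<open>n\<close>, so neither
  restricting the path nor overwriting coordinate \<open>Suc n\<close> affects it. This is what lets
  \<open>chain_law_markov\<close> act on functions of the state, the running sum and the next
  state.\<close>

lemma nn_integral_one_step:
  assumes \<Phi>: "(\<lambda>((z, s), y). \<Phi> z s y) \<in> borel_measurable ((M \<Otimes>\<^sub>M borel) \<Otimes>\<^sub>M M)"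
  shows "(\<integral>\<^sup>+\<omega>. \<Phi> (\<omega> n) (S n \<omega>) (\<omega> (Suc n)) \<partial>law \<xi>) =
    (\<integral>\<^sup>+\<omega>. (\<integral>\<^sup>+y. \<Phi> (\<omega> n) (S n \<omega>) y \<partial>Q (\<omega> n)) \<partial>law \<xi>)"
proof -
  let ?g = "\<lambda>\<omega>. \<Phi> (\<omega> n) (S n \<omega>) (\<omega> (Suc n))"
  have comp[measurable]: "(\<lambda>\<omega>. \<omega> i) \<in> measurable (PiM {0..<Suc (Suc n)} (\<lambda>_. M)) M" if "i < Suc (Suc n)" for i
    using that by (intro measurable_component_singleton) auto
  have Sm: "S n \<in> borel_measurable (PiM {0..<Suc (Suc n)} (\<lambda>_. M))"
    unfolding S_def by (intro borel_measurable_sum measurable_compose[OF comp F_meas]) auto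
  have "(\<lambda>\<omega>. ((\<omega> n, S n \<omega>), \<omega> (Suc n))) \<in> measurable (PiM {0..<Suc (Suc n)} (\<lambda>_. M)) ((M \<Otimes>\<^sub>M borel) \<Otimes>\<^sub>M M)"
    using Sm comp by (intro measurable_Pair) auto
  from measurable_compose[OF this \<Phi>]
  have g: "?g \<in> borel_measurable (PiM {0..<Suc (Suc n)} (\<lambda>_. M))" by simp
  have S1: "S n (restrict \<omega> {0..<Suc (Suc n)}) = S n \<omega>" for \<omega> by (simp add: S_def)
  have S2: "S n ((restrict \<omega> {0..<Suc n})(Suc n := y)) = S n \<omega>" for \<omega> y by (simp add: S_def)
  have S3: "S n (restrict (fun_upd \<omega> (Suc n) y) (insert (Suc n) {0..<Suc n})) = S n \<omega>" for \<omega> y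
    by (simp add: S_def)
  show ?thesis using chain_law_markov[OF kernel \<xi> g] by (simp add: S1 S2 S3)
qed

lemma integral_one_step:
  fixes \<Phi> :: "'a \<Rightarrow> real \<Rightarrow> 'a \<Rightarrow> real"
  assumes \<Phi>[measurable]: "(\<lambda>((z, s), y). \<Phi> z s y) \<in> borel_measurable ((M \<Otimes>\<^sub>M borel) \<Otimes>\<^sub>M M)"
    and bound: "\<And>z s y. z \<in> space M \<Longrightarrow> y \<in> space M \<Longrightarrow> \<bar>s\<bar> \<le> real n * c \<Longrightarrow> \<bar>\<Phi> z s y\<bar> \<le> C"
  shows "(\<integral>\<omega>. \<Phi> (\<omega> n) (S n \<omega>) (\<omega> (Suc n)) \<partial>law \<xi>) =
    (\<integral>\<omega>. (\<integral>y. \<Phi> (\<omega> n) (S n \<omega>) y \<partial>Q (\<omega> n)) \<partial>law \<xi>)"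
proof (rule integral_eq_of_nn_integral_eq[where C = C])
  have fibre: "\<Phi> z s \<in> borel_measurable M" if "z \<in> space M" for z s
    using measurable_compose[OF measurable_Pair1' \<Phi>, of "(z, s)"] that
    by (simp add: space_pair_measure)
  show "prob_space (law \<xi>)" by (rule prob_space_law)
  then show "prob_space (law \<xi>)" .
  have "(\<lambda>\<omega>. ((\<omega> n, S n \<omega>), \<omega> (Suc n))) \<in> measurable (law \<xi>) ((M \<Otimes>\<^sub>M borel) \<Otimes>\<^sub>M M)" by measurable
  from measurable_compose[OF this \<Phi>]
  show "(\<lambda>\<omega>. \<Phi> (\<omega> n) (S n \<omega>) (\<omega> (Suc n))) \<in> borel_measurable (law \<xi>)" by simp
  have inner: "(\<integral>\<^sup>+y. ennreal (\<Phi> (\<omega> n) (S n \<omega>) y + C) \<partial>Q (\<omega> n)) =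
      ennreal ((\<integral>y. \<Phi> (\<omega> n) (S n \<omega>) y \<partial>Q (\<omega> n)) + C)" if \<omega>: "\<omega> \<in> space (law \<xi>)" for \<omega>
  proof -
    note Qz = Q_in[OF law_component[OF \<omega>, of n]]
    interpret Qz: prob_space "Q (\<omega> n)" using prob_algebraD[OF Qz] by simp
    have b: "\<bar>\<Phi> (\<omega> n) (S n \<omega>) y\<bar> \<le> C" if "y \<in> space M" for y
      using that \<omega> by (intro bound S_bound) auto
    have i: "integrable (Q (\<omega> n)) (\<Phi> (\<omega> n) (S n \<omega>))"
      using \<omega> by (intro integrable_prob_algebra_bounded[OF Qz fibre b]) auto
    have nn: "0 \<le> \<Phi> (\<omega> n) (S n \<omega>) y + C" if "y \<in> space (Q (\<omega> n))" for y
      using b[of y] that prob_algebraD[OF Qz] by auto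
    have "(\<integral>\<^sup>+y. ennreal (\<Phi> (\<omega> n) (S n \<omega>) y + C) \<partial>Q (\<omega> n)) =
      ennreal (\<integral>y. \<Phi> (\<omega> n) (S n \<omega>) y + C \<partial>Q (\<omega> n))"
      using i nn by (intro nn_integral_eq_integral) (auto intro: AE_I2)
    then show ?thesis
      using i by (simp add: Qz.prob_space)
  qed
  have innerb: "\<bar>\<integral>y. \<Phi> (\<omega> n) (S n \<omega>) y \<partial>Q (\<omega> n)\<bar> \<le> C" if "\<omega> \<in> space (law \<xi>)" for \<omega>
    using that by (intro integral_prob_algebra_abs_le[OF Q_in fibre] bound S_bound) auto
  then show "\<bar>\<integral>y. \<Phi> (\<omega> n) (S n \<omega>) y \<partial>Q (\<omega> n)\<bar> \<le> C" if "\<omega> \<in> space (law \<xi>)" for \<omega>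
    using that .
  \<comment> \<open>Measurability of the inner integral comes from its nonnegative counterpart:
    \<open>enn2real\<close> of the integral of \<open>\<Phi> + C\<close>, minus \<open>C\<close>,
    agrees with it on the path space.\<close>
  have L: "(\<lambda>zs. Q (fst zs)) \<in> measurable (M \<Otimes>\<^sub>M (borel :: real measure)) (subprob_algebra M)" by measurable
  have "(\<lambda>zs. \<integral>\<^sup>+y. ennreal (\<Phi> (fst zs) (snd zs) y + C) \<partial>Q (fst zs)) \<in> borel_measurable (M \<Otimes>\<^sub>M borel)"
    by (rule nn_integral_measurable_subprob_algebra2[OF _ L]) (use \<Phi> in \<open>simp add: split_beta'\<close>)
  from measurable_compose[OF _ this, of "\<lambda>\<omega>. (\<omega> n, S n \<omega>)" "law \<xi>"]
  have "(\<lambda>\<omega>. enn2real (\<integral>\<^sup>+y. ennreal (\<Phi> (\<omega> n) (S n \<omega>) y + C) \<partial>Q (\<omega> n)) - C) \<in> borel_measurable (law \<xi>)"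
    by simp
  then show "(\<lambda>\<omega>. \<integral>y. \<Phi> (\<omega> n) (S n \<omega>) y \<partial>Q (\<omega> n)) \<in> borel_measurable (law \<xi>)"
  proof (rule measurable_cong[THEN iffD1, rotated])
    fix \<omega> assume \<omega>: "\<omega> \<in> space (law \<xi>)"
    then have "0 \<le> (\<integral>y. \<Phi> (\<omega> n) (S n \<omega>) y \<partial>Q (\<omega> n)) + C" using innerb[OF \<omega>] by auto
    then show "enn2real (\<integral>\<^sup>+y. ennreal (\<Phi> (\<omega> n) (S n \<omega>) y + C) \<partial>Q (\<omega> n)) - C =
      (\<integral>y. \<Phi> (\<omega> n) (S n \<omega>) y \<partial>Q (\<omega> n))"
      by (simp add: inner[OF \<omega>])
  qed
  show "\<bar>\<Phi> (\<omega> n) (S n \<omega>) (\<omega> (Suc n))\<bar> \<le> C" if "\<omega> \<in> space (law \<xi>)" for \<omega>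
    using that by (intro bound S_bound) auto
  have "(\<lambda>((z, s), y). ennreal (\<Phi> z s y + C)) \<in> borel_measurable ((M \<Otimes>\<^sub>M borel) \<Otimes>\<^sub>M M)"
    using \<Phi> by (simp add: split_beta')
  from nn_integral_one_step[OF this, of n]
  have "(\<integral>\<^sup>+\<omega>. ennreal (\<Phi> (\<omega> n) (S n \<omega>) (\<omega> (Suc n)) + C) \<partial>law \<xi>) =
    (\<integral>\<^sup>+\<omega>. (\<integral>\<^sup>+y. ennreal (\<Phi> (\<omega> n) (S n \<omega>) y + C) \<partial>Q (\<omega> n)) \<partial>law \<xi>)" .
  also have "\<dots> = (\<integral>\<^sup>+\<omega>. ennreal ((\<integral>y. \<Phi> (\<omega> n) (S n \<omega>) y \<partial>Q (\<omega> n)) + C) \<partial>law \<xi>)"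
    by (intro nn_integral_cong inner)
  finally show "(\<integral>\<^sup>+\<omega>. ennreal (\<Phi> (\<omega> n) (S n \<omega>) (\<omega> (Suc n)) + C) \<partial>law \<xi>) =
    (\<integral>\<^sup>+\<omega>. ennreal ((\<integral>y. \<Phi> (\<omega> n) (S n \<omega>) y \<partial>Q (\<omega> n)) + C) \<partial>law \<xi>)" .
qed

end

text \<open>The transition operator of the Markov chain \<open>(Z\<^sub>n, S\<^sub>n)\<close>; its state space carries the running sum,
  so its powers give the Markov property of path functionals of the form \<open>\<Phi>(Z\<^sub>n, S\<^sub>n)\<close>.\<close>
definition step_op :: "('a \<Rightarrow> real \<Rightarrow> ennreal) \<Rightarrow> 'a \<Rightarrow> real \<Rightarrow> ennreal" where
  "step_op \<Phi> z s = (\<integral>\<^sup>+y. \<Phi> y (s + F z) \<partial>Q z)"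

lemma measurable_step_op:
  assumes "(\<lambda>(z, s). \<Phi> z s) \<in> borel_measurable (M \<Otimes>\<^sub>M borel)"
  shows "(\<lambda>(z, s). step_op \<Phi> z s) \<in> borel_measurable (M \<Otimes>\<^sub>M borel)"
proof -
  have L: "(\<lambda>zs. Q (fst zs)) \<in> measurable (M \<Otimes>\<^sub>M (borel :: real measure)) (subprob_algebra M)" by measurable
  have "(\<lambda>x. (snd x, snd (fst x) + F (fst (fst x)))) \<in> measurable ((M \<Otimes>\<^sub>M borel) \<Otimes>\<^sub>M M) (M \<Otimes>\<^sub>M borel)"
    by measurable
  from measurable_compose[OF this assms]
  have "(\<lambda>(zs, y). \<Phi> y (snd zs + F (fst zs))) \<in> borel_measurable ((M \<Otimes>\<^sub>M borel) \<Otimes>\<^sub>M M)"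
    by (simp add: split_beta')
  from nn_integral_measurable_subprob_algebra2[OF this L]
  show ?thesis by (simp add: step_op_def split_beta')
qed

lemma measurable_step_op_pow:
  assumes "(\<lambda>(z, s). \<Phi> z s) \<in> borel_measurable (M \<Otimes>\<^sub>M borel)"
  shows "(\<lambda>(z, s). (step_op ^^ n) \<Phi> z s) \<in> borel_measurable (M \<Otimes>\<^sub>M borel)"
  by (induction n) (use assms measurable_step_op in auto)

text \<open>The induction hypothesis is used from time \<open>Suc m\<close>; the transition at time
  \<open>m\<close> then supplies the outermost \<open>step_op\<close>. Hence \<open>m\<close> is
  kept arbitrary.\<close>

lemma nn_integral_step_op:
  assumes \<xi>: "\<xi> \<in> space (prob_algebra M)"
    and \<Phi>: "(\<lambda>(z, s). \<Phi> z s) \<in> borel_measurable (M \<Otimes>\<^sub>M borel)"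
  shows "(\<integral>\<^sup>+\<omega>. \<Phi> (\<omega> (m + n)) (S (m + n) \<omega>) \<partial>law \<xi>) =
    (\<integral>\<^sup>+\<omega>. (step_op ^^ n) \<Phi> (\<omega> m) (S m \<omega>) \<partial>law \<xi>)"
proof (induction n arbitrary: m)
  case (Suc n)
  let ?\<Psi> = "(step_op ^^ n) \<Phi>"
  have "(\<lambda>x. (snd x, snd (fst x) + F (fst (fst x)))) \<in> measurable ((M \<Otimes>\<^sub>M borel) \<Otimes>\<^sub>M M) (M \<Otimes>\<^sub>M borel)"
    by measurable
  from measurable_compose[OF this measurable_step_op_pow[OF \<Phi>]]
  have "(\<lambda>((z, s), y). ?\<Psi> y (s + F z)) \<in> borel_measurable ((M \<Otimes>\<^sub>M borel) \<Otimes>\<^sub>M M)"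
    by (simp add: split_beta')
  from nn_integral_one_step[OF \<xi> this, of m] show ?case
    using Suc[of "Suc m"] by (simp add: step_op_def[of ?\<Psi>])
qed simp

text \<open>Increments of the running sum do not depend on its value, so translations of the sum
  commute with \<open>step_op\<close>. This lets a chain whose sum starts at 0 represent any initial
  offset.\<close>

lemma step_op_pow_shift:
  "(step_op ^^ n) (\<lambda>z s. \<Phi> z (t + s)) z s = (step_op ^^ n) \<Phi> z (t + s)"
  by (induction n arbitrary: z s) (simp_all add: step_op_def add.assoc)

lemma step_op_pow_eq:
  assumes z: "z \<in> space M" and \<Phi>: "(\<lambda>(z, s). \<Phi> z s) \<in> borel_measurable (M \<Otimes>\<^sub>M borel)"
  shows "(step_op ^^ n) \<Phi> z s = (\<integral>\<^sup>+\<omega>. \<Phi> (\<omega> n) (s + S n \<omega>) \<partial>law_from z)"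
proof -
  have \<Phi>': "(\<lambda>(z, t). \<Phi> z (s + t)) \<in> borel_measurable (M \<Otimes>\<^sub>M borel)"
    using measurable_compose[OF _ \<Phi>, of "\<lambda>x. (fst x, s + snd x)" "M \<Otimes>\<^sub>M borel"]
    by (simp add: split_beta')
  have m: "(\<lambda>z. (step_op ^^ n) \<Phi> z s) \<in> borel_measurable M"
    using measurable_compose[OF _ measurable_step_op_pow[OF \<Phi>], of "\<lambda>x. (x, s)" M n] by simp
  have "(\<integral>\<^sup>+\<omega>. \<Phi> (\<omega> n) (s + S n \<omega>) \<partial>law_from z) =
    (\<integral>\<^sup>+\<omega>. (step_op ^^ n) \<Phi> (\<omega> 0) s \<partial>law_from z)"
    using nn_integral_step_op[OF return_in[OF z] \<Phi>', of 0 n] by (simp add: step_op_pow_shift)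
  also have "\<dots> = (step_op ^^ n) \<Phi> z s"
    using chain_law_initial[OF kernel return_in[OF z] m] nn_integral_return[OF z m] by simp
  finally show ?thesis by simp
qed

text \<open>The Markov property at time \<open>m\<close>: in the semigroup identity,
  \<open>step_op_pow_eq\<close> reads the power of \<open>step_op\<close> as an expectation for a
  fresh chain that carries the offset \<open>S m \<omega>\<close>.\<close>

lemma nn_integral_markov:
  assumes \<xi>: "\<xi> \<in> space (prob_algebra M)"
    and \<Phi>: "(\<lambda>(z, s). \<Phi> z s) \<in> borel_measurable (M \<Otimes>\<^sub>M borel)"
  shows "(\<integral>\<^sup>+\<omega>. \<Phi> (\<omega> (m + n)) (S (m + n) \<omega>) \<partial>law \<xi>) =
    (\<integral>\<^sup>+\<omega>. (\<integral>\<^sup>+\<omega>'. \<Phi> (\<omega>' n) (S m \<omega> + S n \<omega>') \<partial>law_from (\<omega> m)) \<partial>law \<xi>)"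
  unfolding nn_integral_step_op[OF \<xi> \<Phi>]
  by (intro nn_integral_cong step_op_pow_eq[OF law_component[OF \<xi>] \<Phi>])

lemma nn_integral_initial:
  assumes \<xi>: "\<xi> \<in> space (prob_algebra M)"
    and \<Phi>: "(\<lambda>(z, s). \<Phi> z s) \<in> borel_measurable (M \<Otimes>\<^sub>M borel)"
  shows "(\<integral>\<^sup>+\<omega>. \<Phi> (\<omega> n) (S n \<omega>) \<partial>law \<xi>) =
    (\<integral>\<^sup>+z. (\<integral>\<^sup>+\<omega>. \<Phi> (\<omega> n) (S n \<omega>) \<partial>law_from z) \<partial>\<xi>)"
proof -
  have m: "(\<lambda>z. (step_op ^^ n) \<Phi> z 0) \<in> borel_measurable M"
    using measurable_compose[OF _ measurable_step_op_pow[OF \<Phi>], of "\<lambda>x. (x, 0)" M n] by simp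
  have "(\<integral>\<^sup>+\<omega>. \<Phi> (\<omega> n) (S n \<omega>) \<partial>law \<xi>) = (\<integral>\<^sup>+z. (step_op ^^ n) \<Phi> z 0 \<partial>\<xi>)"
    using nn_integral_step_op[OF \<xi> \<Phi>, of 0 n] chain_law_initial[OF kernel \<xi> m] by simp
  also have "\<dots> = (\<integral>\<^sup>+z. (\<integral>\<^sup>+\<omega>. \<Phi> (\<omega> n) (S n \<omega>) \<partial>law_from z) \<partial>\<xi>)"
    using prob_algebraD[OF \<xi>] by (intro nn_integral_cong) (simp add: step_op_pow_eq[OF _ \<Phi>])
  finally show ?thesis .
qed

end

subsection \<open>Poisson equations\<close>

text \<open>The exponent is constant on blocks of \<tau> consecutive indices, so the series is
  \<tau> copies of a geometric series with sum 4/3.\<close>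

lemma sums_quarter_pow_div:
  assumes "1 \<le> (\<tau>::nat)"
  shows "(\<lambda>j. (1 / 4 :: real) ^ (j div \<tau>)) sums (4 / 3 * real \<tau>)"
proof -
  let ?f = "\<lambda>j. (1 / 4 :: real) ^ (j div \<tau>)"
  have block: "sum ?f {m * \<tau>..<m * \<tau> + \<tau>} = real \<tau> * (1 / 4) ^ m" for m
  proof -
    have "j div \<tau> = m" if "j \<in> {m * \<tau>..<m * \<tau> + \<tau>}" for j
      using that by (intro div_nat_eqI) (auto simp: mult.commute)
    then have "sum ?f {m * \<tau>..<m * \<tau> + \<tau>} = (\<Sum>j\<in>{m * \<tau>..<m * \<tau> + \<tau>}. (1 / 4) ^ m)"
      by (intro sum.cong) auto
    then show ?thesis by simp
  qed
  have geo: "(\<lambda>m. real \<tau> * (1 / 4) ^ m) sums (real \<tau> * (4 / 3))"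
    using sums_mult[OF geometric_sums[of "1 / 4 :: real"], of "real \<tau>"] by simp
  have "summable ?f"
  proof (rule summableI_nonneg_bounded)
    fix n
    \<comment> \<open>Going up to \<open>n * \<tau>\<close> terms completes all blocks.\<close>
    have "sum ?f {..<n} \<le> sum ?f {..<n * \<tau>}"
      using assms by (intro sum_mono2) (auto intro: order_less_le_trans)
    also have "\<dots> = (\<Sum>m<n. real \<tau> * (1 / 4) ^ m)"
      by (subst sum.nat_group[symmetric]) (simp add: block)
    also have "\<dots> \<le> real \<tau> * (4 / 3)"
      using sum_le_suminf[OF sums_summable[OF geo], of "{..<n}"] sums_unique[OF geo] by simp
    finally show "sum ?f {..<n} \<le> real \<tau> * (4 / 3)" .
  qed simp
  then have "(\<lambda>m. sum ?f {m * \<tau>..<m * \<tau> + \<tau>}) sums suminf ?f"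
    using assms by (intro sums_group summable_sums) auto
  then have "suminf ?f = real \<tau> * (4 / 3)"
    using sums_unique2[OF geo] by (simp add: block)
  with \<open>summable ?f\<close> show ?thesis by (simp add: sums_iff)
qed

section \<open>Powers of the transition operator\<close>

context additive_functional
begin

abbreviation P :: "nat \<Rightarrow> ('a \<Rightarrow> real) \<Rightarrow> 'a \<Rightarrow> real" where
  "P n \<equiv> kernel_op (kernel_pow M Q n)"

lemma P_meas[measurable]: "u \<in> borel_measurable M \<Longrightarrow> P n u \<in> borel_measurable M"
  unfolding kernel_op_def[abs_def] by (rule measurable_kernel_integral[OF measurable_kernel_pow[OF kernel]])

lemma P_abs_le:
  assumes "u \<in> borel_measurable M" "\<And>x. x \<in> space M \<Longrightarrow> \<bar>u x\<bar> \<le> C" "z \<in> space M"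
  shows "\<bar>P n u z\<bar> \<le> C"
  unfolding kernel_op_def by (rule integral_prob_algebra_abs_le[OF kernel_pow_in[OF assms(3)] assms(1,2)])

lemma P_0: "u \<in> borel_measurable M \<Longrightarrow> z \<in> space M \<Longrightarrow> P 0 u z = u z"
  by (simp add: kernel_op_def integral_return)

lemma P_1:
  assumes "z \<in> space M"
  shows "P 1 u z = (\<integral>y. u y \<partial>Q z)"
proof -
  have "kernel_pow M Q 0 = return M" by (simp add: fun_eq_iff)
  then have "kernel_pow M Q 1 z = Q z"
    using bind_return''[OF prob_algebraD(2)[OF Q_in[OF assms]]] by simp
  then show ?thesis by (simp add: kernel_op_def)
qed

lemma P_add:
  assumes "u \<in> borel_measurable M" "\<And>x. x \<in> space M \<Longrightarrow> \<bar>u x\<bar> \<le> C" "z \<in> space M"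
  shows "P (m + n) u z = P m (P n u) z"
  unfolding kernel_op_def kernel_pow_add[OF kernel assms(3)]
  by (rule integral_bind_bounded[OF kernel_pow_in[OF assms(3)] measurable_kernel_pow[OF kernel] assms(1,2)])

lemma integral_law_0:
  assumes \<xi>: "\<xi> \<in> space (prob_algebra M)"
    and u: "u \<in> borel_measurable M" "\<And>x. x \<in> space M \<Longrightarrow> \<bar>u x\<bar> \<le> (C::real)"
  shows "(\<integral>\<omega>. u (\<omega> 0) \<partial>law \<xi>) = (\<integral>z. u z \<partial>\<xi>)"
proof (rule integral_eq_of_nn_integral_eq[where C = C])
  show "prob_space (law \<xi>)" "prob_space \<xi>" using prob_space_law \<xi> prob_algebraD by auto
  show "u \<in> borel_measurable \<xi>" using u prob_algebraD[OF \<xi>] by (simp cong: measurable_cong_sets)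
  show "(\<lambda>\<omega>. u (\<omega> 0)) \<in> borel_measurable (law \<xi>)"
    by (rule measurable_compose[OF law_component_measurable[OF \<xi>] u(1)])
  show "(\<integral>\<^sup>+\<omega>. ennreal (u (\<omega> 0) + C) \<partial>law \<xi>) = (\<integral>\<^sup>+z. ennreal (u z + C) \<partial>\<xi>)"
    by (rule chain_law_initial[OF kernel \<xi>]) (use u in measurable)
qed (use u prob_algebraD[OF \<xi>] law_component[OF \<xi>] in auto)

text \<open>The last transition replaces \<open>u\<close> by \<open>P 1 u\<close>, so the induction
  has to run over all bounded \<open>u\<close>.\<close>

lemma integral_law_component:
  assumes \<xi>: "\<xi> \<in> space (prob_algebra M)"
    and u: "u \<in> borel_measurable M" "\<And>x. x \<in> space M \<Longrightarrow> \<bar>u x\<bar> \<le> (C::real)"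
  shows "(\<integral>\<omega>. u (\<omega> n) \<partial>law \<xi>) = (\<integral>z. P n u z \<partial>\<xi>)"
  using u
proof (induction n arbitrary: u)
  case 0
  have "(\<integral>z. P 0 u z \<partial>\<xi>) = (\<integral>z. u z \<partial>\<xi>)"
    using 0 prob_algebraD[OF \<xi>] by (intro Bochner_Integration.integral_cong) (auto simp: P_0)
  with integral_law_0[OF \<xi> 0] show ?case by (simp only:)
next
  case (Suc n)
  note [measurable] = Suc.prems(1)
  have "(\<integral>\<omega>. u (\<omega> (Suc n)) \<partial>law \<xi>) = (\<integral>\<omega>. (\<integral>y. u y \<partial>Q (\<omega> n)) \<partial>law \<xi>)"
    using Suc.prems(2)
    by (intro integral_one_step[OF \<xi>, of "\<lambda>z s y. u y" n C]) (auto simp: split_beta')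
  also have "\<dots> = (\<integral>\<omega>. P 1 u (\<omega> n) \<partial>law \<xi>)"
    using law_component[OF \<xi>] by (intro Bochner_Integration.integral_cong) (auto simp: P_1 simp del: One_nat_def)
  also have "\<dots> = (\<integral>z. P n (P 1 u) z \<partial>\<xi>)"
    by (intro Suc.IH P_meas P_abs_le Suc.prems)
  also have "\<dots> = (\<integral>z. P (Suc n) u z \<partial>\<xi>)"
    using prob_algebraD[OF \<xi>] P_add[OF Suc.prems, of _ n 1]
    by (intro Bochner_Integration.integral_cong) auto
  finally show ?case .
qed

lemma integral_law_from_component:
  assumes "z \<in> space M" and "u \<in> borel_measurable M" "\<And>x. x \<in> space M \<Longrightarrow> \<bar>u x\<bar> \<le> C"
  shows "(\<integral>\<omega>. u (\<omega> n) \<partial>law_from z) = P n u z"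
  using integral_law_component[OF return_in[OF assms(1)] assms(2,3), of n] assms
  by (simp add: integral_return)

lemma law_integrable:
  fixes X :: "(nat \<Rightarrow> 'a) \<Rightarrow> real"
  assumes "\<xi> \<in> space (prob_algebra M)" "X \<in> borel_measurable (law \<xi>)"
    and "\<And>\<omega>. \<omega> \<in> space (law \<xi>) \<Longrightarrow> \<bar>X \<omega>\<bar> \<le> C"
  shows "integrable (law \<xi>) X"
proof -
  interpret prob_space "law \<xi>" by (rule prob_space_law[OF assms(1)])
  show ?thesis using assms by (intro integrable_const_bound[where B = C] AE_I2) auto
qed

end

text \<open>Mixing is recorded set by set, the form that
  \<open>integral_abs_diff_le_measure_diff\<close> consumes; \<open>measure_diff_le_half_tv\<close>
  derives it from \<open>UGE\<close>.\<close>

locale ergodic_functional = additive_functional +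
  fixes \<pi> :: "'a measure" and \<tau> :: nat
  assumes \<pi>_in: "\<pi> \<in> space (prob_algebra M)" and invariant: "\<pi> \<bind> Q = \<pi>"
    and \<tau>: "1 \<le> \<tau>"
    and mixing: "\<And>n z A. z \<in> space M \<Longrightarrow> A \<in> sets M \<Longrightarrow>
      \<bar>measure (kernel_pow M Q n z) A - measure \<pi> A\<bar> \<le> (1 / 4) ^ (n div \<tau>)"
    and centred: "(\<integral>z. F z \<partial>\<pi>) = 0"
begin

lemma invariant_pow: "\<pi> \<bind> kernel_pow M Q n = \<pi>"
proof (induction n)
  case 0
  have "kernel_pow M Q 0 = return M" by (simp add: fun_eq_iff)
  then show ?case using bind_return''[OF prob_algebraD(2)[OF \<pi>_in]] by simp
next
  case (Suc n)
  have "kernel_pow M Q (Suc n) = (\<lambda>z. Q z \<bind> kernel_pow M Q n)" by (simp add: fun_eq_iff)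
  then have "\<pi> \<bind> kernel_pow M Q (Suc n) = (\<pi> \<bind> Q) \<bind> kernel_pow M Q n"
    using prob_algebraD[OF \<pi>_in] measurable_prob_algebraD[OF measurable_kernel_pow[OF kernel]]
    by (subst bind_assoc[where N = M and R = M]) (auto cong: measurable_cong_sets)
  then show ?case using Suc invariant by (simp only:)
qed

lemma integral_P_invariant:
  assumes "u \<in> borel_measurable M" "\<And>x. x \<in> space M \<Longrightarrow> \<bar>u x\<bar> \<le> C"
  shows "(\<integral>z. P n u z \<partial>\<pi>) = (\<integral>z. u z \<partial>\<pi>)"
  using integral_bind_bounded[OF \<pi>_in measurable_kernel_pow[OF kernel] assms, of n]
  by (simp add: kernel_op_def invariant_pow)

lemma P_mixing:
  assumes "u \<in> borel_measurable M" "\<And>x. x \<in> space M \<Longrightarrow> a \<le> u x" "\<And>x. x \<in> space M \<Longrightarrow> u x \<le> b"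
    and z: "z \<in> space M"
  shows "\<bar>P n u z - (\<integral>x. u x \<partial>\<pi>)\<bar> \<le> (b - a) * (1 / 4) ^ (n div \<tau>)"
  unfolding kernel_op_def
  by (rule integral_abs_diff_le_measure_diff[OF kernel_pow_in[OF z] \<pi>_in mixing[OF z] assms(1-3)])

text \<open>The series solution of the Poisson equation of \<open>Q\<^sup>t\<close>. It serves with
  step 1 for \<open>F\<close> and with step \<tau> for the block variance \<open>H\<close>.\<close>

definition poisson :: "nat \<Rightarrow> ('a \<Rightarrow> real) \<Rightarrow> 'a \<Rightarrow> real" where
  "poisson t u z = (\<Sum>j. P (j * t) u z - (\<integral>x. u x \<partial>\<pi>))"

context
  fixes t :: nat and u :: "'a \<Rightarrow> real" and a b s :: real
  assumes u[measurable]: "u \<in> borel_measurable M"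
    and ua: "\<And>x. x \<in> space M \<Longrightarrow> a \<le> u x" and ub: "\<And>x. x \<in> space M \<Longrightarrow> u x \<le> b"
    and s: "(\<lambda>j. (1 / 4 :: real) ^ ((j * t) div \<tau>)) sums s"
begin

lemma poisson_term_bound:
  assumes "z \<in> space M"
  shows "\<bar>P n u z - (\<integral>x. u x \<partial>\<pi>)\<bar> \<le> (b - a) * (1 / 4) ^ (n div \<tau>)"
  by (rule P_mixing[OF u ua ub assms])

lemma poisson_summable:
  assumes "z \<in> space M"
  shows "summable (\<lambda>j. \<bar>P (j * t) u z - (\<integral>x. u x \<partial>\<pi>)\<bar>)"
  using poisson_term_bound[OF assms]
  by (intro summable_comparison_test[OF _ summable_mult[OF sums_summable[OF s]], of _ "b - a"]) auto

text \<open>Mixing bounds the series term by term. The sum \<open>s\<close> of the rates is 4/3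
  \<tau> for \<open>t = 1\<close> but only 4/3 for \<open>t = \<tau>\<close>, where one term stands
  for a whole block.\<close>

lemma poisson_abs_le:
  assumes z: "z \<in> space M"
  shows "\<bar>poisson t u z\<bar> \<le> (b - a) * s"
proof -
  have "\<bar>poisson t u z\<bar> \<le> (\<Sum>j. \<bar>P (j * t) u z - (\<integral>x. u x \<partial>\<pi>)\<bar>)"
    unfolding poisson_def by (rule summable_rabs[OF poisson_summable[OF z]])
  also have "\<dots> \<le> (\<Sum>j. (b - a) * (1 / 4) ^ ((j * t) div \<tau>))"
    using poisson_summable[OF z] summable_mult[OF sums_summable[OF s]] poisson_term_bound[OF z]
    by (intro suminf_le) auto
  also have "\<dots> = (b - a) * s" using sums_mult[OF s] by (rule sums_unique[symmetric])
  finally show ?thesis .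
qed

lemma poisson_meas[measurable]: "poisson t u \<in> borel_measurable M"
  unfolding poisson_def[abs_def] by measurable

text \<open>Dominated exchange of sum and integral. With \<open>v = 1\<close> under a transition
  probability it yields the Poisson equation, with \<open>v = F\<close> under \<pi> the covariance
  series in \<open>integral_h\<close>.\<close>

lemma integral_mult_poisson:
  assumes \<mu>: "\<mu> \<in> space (prob_algebra M)"
    and v[measurable]: "v \<in> borel_measurable M" and vC: "\<And>x. x \<in> space M \<Longrightarrow> \<bar>v x\<bar> \<le> C"
  shows "(\<lambda>j. \<integral>x. v x * (P (j * t) u x - (\<integral>x. u x \<partial>\<pi>)) \<partial>\<mu>) sums (\<integral>x. v x * poisson t u x \<partial>\<mu>)"
proof -
  let ?m = "\<integral>x. u x \<partial>\<pi>"
  let ?f = "\<lambda>j x. v x * (P (j * t) u x - ?m)"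
  let ?r = "\<lambda>j. C * ((b - a) * (1 / 4) ^ ((j * t) div \<tau>))"
  note \<mu>' = prob_algebraD[OF \<mu>]
  have bound: "\<bar>?f j x\<bar> \<le> ?r j" if "x \<in> space M" for j x
    unfolding abs_mult using vC[OF that] poisson_term_bound[OF that] by (intro mult_mono') auto
  have sr: "summable ?r" by (intro summable_mult sums_summable[OF s])
  have int: "integrable \<mu> (?f j)" for j
    by (rule integrable_prob_algebra_bounded[OF \<mu> _ bound]) measurable
  have AE: "AE x in \<mu>. summable (\<lambda>j. norm (?f j x))"
    using bound \<mu>' sr by (intro AE_I2 summable_comparison_test[OF _ sr]) auto
  have "\<bar>\<integral>x. norm (?f j x) \<partial>\<mu>\<bar> \<le> ?r j" for j
    using bound by (intro integral_prob_algebra_abs_le[OF \<mu>]) auto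
  then have sum: "summable (\<lambda>j. \<integral>x. norm (?f j x) \<partial>\<mu>)"
    by (intro summable_comparison_test[OF _ sr]) auto
  have sums: "(\<lambda>j. integral\<^sup>L \<mu> (?f j)) sums (\<integral>x. (\<Sum>j. ?f j x) \<partial>\<mu>)"
    by (rule sums_integral[OF int AE sum])
  have "(\<integral>x. (\<Sum>j. ?f j x) \<partial>\<mu>) = (\<integral>x. v x * poisson t u x \<partial>\<mu>)"
  proof (rule Bochner_Integration.integral_cong[OF refl])
    fix x assume "x \<in> space \<mu>"
    then have "x \<in> space M" using \<mu>' by simp
    then have "summable (\<lambda>j. P (j * t) u x - ?m)"
      by (intro summable_rabs_cancel[OF poisson_summable])
    then show "(\<Sum>j. ?f j x) = v x * poisson t u x"
      unfolding poisson_def by (rule suminf_mult)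
  qed
  with sums show ?thesis by (simp only:)
qed

text \<open>Applying \<open>P t\<close> shifts the series by one index; only the zeroth term,
  \<open>u z\<close> minus the mean, is lost.\<close>

lemma poisson_equation:
  assumes z: "z \<in> space M"
  shows "P t (poisson t u) z = poisson t u z - u z + (\<integral>x. u x \<partial>\<pi>)"
proof -
  let ?m = "\<integral>x. u x \<partial>\<pi>"
  let ?C = "max \<bar>a\<bar> \<bar>b\<bar>"
  have uC: "\<bar>u x\<bar> \<le> ?C" if "x \<in> space M" for x using ua[OF that] ub[OF that] by auto
  interpret Kz: prob_space "kernel_pow M Q t z" using prob_algebraD[OF kernel_pow_in[OF z]] by simp
  have "(\<lambda>j. \<integral>x. 1 * (P (j * t) u x - ?m) \<partial>kernel_pow M Q t z) sums (\<integral>x. 1 * poisson t u x \<partial>kernel_pow M Q t z)"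
    by (rule integral_mult_poisson[OF kernel_pow_in[OF z], of _ 1]) auto
  moreover have "(\<integral>x. 1 * (P (j * t) u x - ?m) \<partial>kernel_pow M Q t z) = P (Suc j * t) u z - ?m" for j
  proof -
    have "integrable (kernel_pow M Q t z) (P (j * t) u)"
      by (rule integrable_prob_algebra_bounded[OF kernel_pow_in[OF z] P_meas[OF u] P_abs_le[OF u uC]])
    then have "(\<integral>x. 1 * (P (j * t) u x - ?m) \<partial>kernel_pow M Q t z) = P t (P (j * t) u) z - ?m"
      by (simp add: kernel_op_def[of _ "P (j * t) u"] Kz.prob_space)
    then show ?thesis using P_add[OF u uC z, of t "j * t"] by (simp add: add.commute)
  qed
  ultimately have "(\<lambda>j. P (Suc j * t) u z - ?m) sums P t (poisson t u) z"
    by (simp add: kernel_op_def)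
  moreover have "(\<lambda>j. P (Suc j * t) u z - ?m) sums (poisson t u z - (P (0 * t) u z - ?m))"
    unfolding poisson_def using poisson_summable[OF z]
    by (subst sums_Suc_iff) (auto intro!: summable_sums summable_rabs_cancel)
  ultimately have "P t (poisson t u) z = poisson t u z - (P (0 * t) u z - ?m)"
    by (rule sums_unique2)
  then show ?thesis using P_0[OF u z] by simp
qed

end

end

subsection \<open>The block martingale and its conditional variance\<close>

lemma exp_le_quadratic:
  fixes y :: real
  assumes "y \<le> 1"
  shows "exp y \<le> 1 + y + y\<^sup>2"
proof (cases "0 \<le> y")
  case True
  then show ?thesis using exp_bound assms by simp
next
  case False
  define x where "x = - y"
  have x: "0 \<le> x" using False by (simp add: x_def)
  have q: "1 + x + x\<^sup>2 / 2 \<le> exp x" by (rule exp_lower_Taylor_quadratic[OF x])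
  have pos: "0 < 1 - x + x\<^sup>2 / 2"
    using zero_le_power2[of "x - 1"] by (simp add: power2_eq_square algebra_simps)
  \<comment> \<open>The product equals 1 + x^4/4.\<close>
  have "1 \<le> (1 - x + x\<^sup>2 / 2) * (1 + x + x\<^sup>2 / 2)"
    using x by (simp add: algebra_simps power2_eq_square)
  also have "\<dots> \<le> (1 - x + x\<^sup>2 / 2) * exp x"
    using q pos by (intro mult_left_mono) auto
  finally have "exp (- x) \<le> 1 - x + x\<^sup>2 / 2" by (simp add: exp_minus field_simps)
  then have "exp y \<le> 1 + y + y\<^sup>2 / 2" by (simp add: x_def)
  then show ?thesis using zero_le_power2[of y] by linarith
qed

context ergodic_functional
begin

definition g :: "'a \<Rightarrow> real" where "g = poisson 1 F"

text \<open>The conditional variance of \<open>g\<close> at the next state, which is that of one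
  martingale increment.\<close>

definition h :: "'a \<Rightarrow> real" where "h z = P 1 (\<lambda>y. (g y)\<^sup>2) z - (P 1 g z)\<^sup>2"

definition var :: real where
  "var = (\<integral>z. (F z)\<^sup>2 \<partial>\<pi>) + 2 * (\<Sum>l. \<integral>z. F z * P (Suc l) F z \<partial>\<pi>)"

text \<open>The block martingale is bounded by \<tau> c + 2 \<open>cg\<close> = 19/3 \<tau> c,
  rounded up to 7 \<tau> c.\<close>

definition b :: real where "b = 7 * real \<tau> * c"

abbreviation cg :: real where "cg \<equiv> 8 / 3 * c * real \<tau>"

lemma F_ge: "z \<in> space M \<Longrightarrow> - c \<le> F z" and F_le: "z \<in> space M \<Longrightarrow> F z \<le> c"
  using F_bound[of z] by auto

lemma sums_div_1: "(\<lambda>j. (1 / 4 :: real) ^ ((j * 1) div \<tau>)) sums (4 / 3 * real \<tau>)"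
  using sums_quarter_pow_div[OF \<tau>] by simp

lemma sums_div_\<tau>: "(\<lambda>j. (1 / 4 :: real) ^ ((j * \<tau>) div \<tau>)) sums (4 / 3)"
  using geometric_sums[of "1 / 4 :: real"] \<tau> by simp

lemma g_meas[measurable]: "g \<in> borel_measurable M"
  unfolding g_def by (rule poisson_meas[OF F_meas F_ge F_le sums_div_1])

lemma g_bound: "z \<in> space M \<Longrightarrow> \<bar>g z\<bar> \<le> cg"
  using poisson_abs_le[OF F_meas F_ge F_le sums_div_1, of z] by (simp add: g_def)

lemma g_sq_bound: "z \<in> space M \<Longrightarrow> \<bar>(g z)\<^sup>2\<bar> \<le> cg\<^sup>2"
  using g_bound[of z] power_mono[of "\<bar>g z\<bar>" cg 2] by simp

lemma P_g: "z \<in> space M \<Longrightarrow> P 1 g z = g z - F z"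
  using poisson_equation[OF F_meas F_ge F_le sums_div_1, of z] by (simp only: g_def centred)

lemma h_meas[measurable]: "h \<in> borel_measurable M"
  unfolding h_def[abs_def] by measurable

lemma h_bound:
  assumes z: "z \<in> space M"
  shows "\<bar>h z\<bar> \<le> 2 * cg\<^sup>2"
proof -
  have "\<bar>P 1 (\<lambda>y. (g y)\<^sup>2) z\<bar> \<le> cg\<^sup>2" by (rule P_abs_le[OF _ g_sq_bound z]) measurable
  moreover have "\<bar>P 1 g z\<bar> \<le> cg" by (rule P_abs_le[OF _ g_bound z]) measurable
  then have "(P 1 g z)\<^sup>2 \<le> cg\<^sup>2" using power_mono[of "\<bar>P 1 g z\<bar>" cg 2] by simp
  ultimately show ?thesis unfolding h_def using zero_le_power2[of "P 1 g z"] by linarith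
qed

text \<open>As \<open>P 1 g = g - F\<close>, invariance cancels the two integrals of the square of
  \<open>g\<close> and leaves 2 \<pi>(F g) - \<pi>(F^2). The zeroth term of the series of
  \<open>g\<close> contributes 2 \<pi>(F^2), which turns the minus into a plus.\<close>

lemma integral_h: "(\<integral>z. h z \<partial>\<pi>) = var"
proof -
  note int = integrable_prob_algebra_bounded[OF \<pi>_in]
  note space\<pi> = prob_algebraD(3)[OF \<pi>_in]
  have iF2: "integrable \<pi> (\<lambda>z. (F z)\<^sup>2)"
    by (rule int[where C = "c\<^sup>2"]) (use F_bound power_mono[of "\<bar>F _\<bar>" c 2] in auto)
  have ig2: "integrable \<pi> (\<lambda>z. (g z)\<^sup>2)"
    by (rule int[OF _ g_sq_bound]) measurable
  have iFg: "integrable \<pi> (\<lambda>z. F z * g z)"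
  proof (rule int[where C = "c * cg"])
    show "\<bar>F z * g z\<bar> \<le> c * cg" if "z \<in> space M" for z
      unfolding abs_mult by (rule mult_mono'[OF F_bound[OF that] g_bound[OF that]]) auto
  qed measurable
  have iPg2: "integrable \<pi> (P 1 (\<lambda>z. (g z)\<^sup>2))"
    by (rule int[OF P_meas P_abs_le[OF _ g_sq_bound]]) auto
  have "(\<integral>z. h z \<partial>\<pi>) = (\<integral>z. P 1 (\<lambda>z. (g z)\<^sup>2) z - ((g z)\<^sup>2 - 2 * (F z * g z) + (F z)\<^sup>2) \<partial>\<pi>)"
    by (rule Bochner_Integration.integral_cong)
       (simp_all add: h_def P_g[simplified] space\<pi> power2_diff algebra_simps)
  also have "\<dots> = (\<integral>z. P 1 (\<lambda>z. (g z)\<^sup>2) z \<partial>\<pi>) -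
      ((\<integral>z. (g z)\<^sup>2 \<partial>\<pi>) - 2 * (\<integral>z. F z * g z \<partial>\<pi>) + (\<integral>z. (F z)\<^sup>2 \<partial>\<pi>))"
    using iF2 ig2 iFg iPg2 by simp
  also have "(\<integral>z. P 1 (\<lambda>z. (g z)\<^sup>2) z \<partial>\<pi>) = (\<integral>z. (g z)\<^sup>2 \<partial>\<pi>)"
    by (rule integral_P_invariant[OF _ g_sq_bound]) measurable
  finally have eq: "(\<integral>z. h z \<partial>\<pi>) = 2 * (\<integral>z. F z * g z \<partial>\<pi>) - (\<integral>z. (F z)\<^sup>2 \<partial>\<pi>)" by simp
  have s: "(\<lambda>j. \<integral>z. F z * P j F z \<partial>\<pi>) sums (\<integral>z. F z * g z \<partial>\<pi>)"
    using integral_mult_poisson[OF F_meas F_ge F_le sums_div_1 \<pi>_in F_meas F_bound]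
    by (simp add: centred g_def)
  have "(\<integral>z. F z * P 0 F z \<partial>\<pi>) = (\<integral>z. (F z)\<^sup>2 \<partial>\<pi>)"
    using P_0[OF F_meas] space\<pi>
    by (intro Bochner_Integration.integral_cong) (auto simp: power2_eq_square)
  then have "(\<Sum>l. \<integral>z. F z * P (Suc l) F z \<partial>\<pi>) = (\<integral>z. F z * g z \<partial>\<pi>) - (\<integral>z. (F z)\<^sup>2 \<partial>\<pi>)"
    using suminf_split_head[OF sums_summable[OF s]] sums_unique[OF s] by simp
  then show ?thesis by (simp add: eq var_def)
qed

text \<open>When the chain starts at \<open>z\<close>, this is the sum over k < n of the increments
  g(Z_(k+1)) - (P 1 g)(Z_k), because \<open>F = g - P 1 g\<close>; hence it is a martingale.\<close>

definition D :: "'a \<Rightarrow> nat \<Rightarrow> (nat \<Rightarrow> 'a) \<Rightarrow> real" where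
  "D z n \<omega> = S n \<omega> + g (\<omega> n) - g z"

context
  fixes z assumes z: "z \<in> space M"
begin

lemma D_meas[measurable]: "D z n \<in> borel_measurable (law_from z)"
proof -
  note [measurable] = law_component_measurable[OF return_in[OF z]] law_S_measurable[OF return_in[OF z]]
  show ?thesis unfolding D_def[abs_def] by measurable
qed

lemma D_bound:
  assumes "\<omega> \<in> space (law_from z)"
  shows "\<bar>D z n \<omega>\<bar> \<le> real n * c + 2 * cg"
  using S_bound[OF return_in[OF z] assms, of n] g_bound[OF law_component[OF return_in[OF z] assms, of n]]
    g_bound[OF z] unfolding D_def by linarith

lemma integral_D: "(\<integral>\<omega>. D z n \<omega> \<partial>law_from z) = 0"
proof (induction n)
  case 0
  have "(\<integral>\<omega>. g (\<omega> 0) - g z \<partial>law_from z) = P 0 (\<lambda>x. g x - g z) z"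
  proof (rule integral_law_from_component[OF z, of _ "2 * cg"])
    show "\<bar>g x - g z\<bar> \<le> 2 * cg" if "x \<in> space M" for x
      using g_bound[OF that] g_bound[OF z] by linarith
  qed measurable
  then show ?case using z P_0[of "\<lambda>x. g x - g z" z] by (simp add: D_def)
next
  case (Suc n)
  note space_law' = law_component[OF return_in[OF z]]
  have "(\<integral>\<omega>. D z (Suc n) \<omega> \<partial>law_from z) = (\<integral>\<omega>. (S n \<omega> + F (\<omega> n) + g (\<omega> (Suc n)) - g z) \<partial>law_from z)"
    by (simp add: D_def)
  also have "\<dots> = (\<integral>\<omega>. (\<integral>y. S n \<omega> + F (\<omega> n) + g y - g z \<partial>Q (\<omega> n)) \<partial>law_from z)"
  proof (rule integral_one_step[OF return_in[OF z], of "\<lambda>x s y. s + F x + g y - g z" n "real n * c + c + 2 * cg"])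
    show "(\<lambda>((x, s), y). s + F x + g y - g z) \<in> borel_measurable ((M \<Otimes>\<^sub>M borel) \<Otimes>\<^sub>M M)"
      unfolding split_beta' by measurable
    show "\<bar>s + F x + g y - g z\<bar> \<le> real n * c + c + 2 * cg"
      if "x \<in> space M" "y \<in> space M" "\<bar>s\<bar> \<le> real n * c" for x s y
      using F_bound[OF that(1)] g_bound[OF that(2)] g_bound[OF z] that(3) by linarith
  qed
  also have "\<dots> = (\<integral>\<omega>. D z n \<omega> \<partial>law_from z)"
  proof (rule Bochner_Integration.integral_cong[OF refl])
    fix \<omega> assume "\<omega> \<in> space (law_from z)"
    then have x: "\<omega> n \<in> space M" by (rule space_law')
    interpret Qx: prob_space "Q (\<omega> n)" using prob_algebraD[OF Q_in[OF x]] by simp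
    have "integrable (Q (\<omega> n)) g" by (rule integrable_prob_algebra_bounded[OF Q_in[OF x] g_meas g_bound])
    then have "(\<integral>y. S n \<omega> + F (\<omega> n) + g y - g z \<partial>Q (\<omega> n)) = S n \<omega> + F (\<omega> n) + P 1 g (\<omega> n) - g z"
      unfolding P_1[OF x] by (simp add: Qx.prob_space)
    then show "(\<integral>y. S n \<omega> + F (\<omega> n) + g y - g z \<partial>Q (\<omega> n)) = D z n \<omega>"
      unfolding P_g[OF x] D_def by simp
  qed
  finally show ?case using Suc by simp
qed

text \<open>Orthogonality of martingale increments: each step adds the expectation of its
  conditional variance.\<close>

lemma integral_D_sq: "(\<integral>\<omega>. (D z n \<omega>)\<^sup>2 \<partial>law_from z) = (\<Sum>k<n. P k h z)"
proof (induction n)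
  case 0
  have "(\<integral>\<omega>. (g (\<omega> 0) - g z)\<^sup>2 \<partial>law_from z) = P 0 (\<lambda>x. (g x - g z)\<^sup>2) z"
  proof (rule integral_law_from_component[OF z, of _ "(2 * cg)\<^sup>2"])
    fix x assume "x \<in> space M"
    then have "\<bar>g x - g z\<bar> \<le> 2 * cg" using g_bound[of x] g_bound[OF z] by linarith
    then show "\<bar>(g x - g z)\<^sup>2\<bar> \<le> (2 * cg)\<^sup>2" using power_mono[of "\<bar>g x - g z\<bar>" "2 * cg" 2] by simp
  qed measurable
  then show ?case using z P_0[of "\<lambda>x. (g x - g z)\<^sup>2" z] by (simp add: D_def)
next
  case (Suc n)
  note space_law' = law_component[OF return_in[OF z]]
  note [measurable] = law_component_measurable[OF return_in[OF z]] law_S_measurable[OF return_in[OF z]]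
  let ?C = "real n * c + c + 2 * cg"
  have "(\<integral>\<omega>. (D z (Suc n) \<omega>)\<^sup>2 \<partial>law_from z) =
      (\<integral>\<omega>. (S n \<omega> + F (\<omega> n) + g (\<omega> (Suc n)) - g z)\<^sup>2 \<partial>law_from z)"
    by (simp add: D_def)
  also have "\<dots> = (\<integral>\<omega>. (\<integral>y. (S n \<omega> + F (\<omega> n) + g y - g z)\<^sup>2 \<partial>Q (\<omega> n)) \<partial>law_from z)"
  proof (rule integral_one_step[OF return_in[OF z], of "\<lambda>x s y. (s + F x + g y - g z)\<^sup>2" n "?C\<^sup>2"])
    show "(\<lambda>((x, s), y). (s + F x + g y - g z)\<^sup>2) \<in> borel_measurable ((M \<Otimes>\<^sub>M borel) \<Otimes>\<^sub>M M)"
      unfolding split_beta' by measurable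
    fix x s y assume xy: "x \<in> space M" "y \<in> space M" "\<bar>s\<bar> \<le> real n * c"
    have "\<bar>s + F x + g y - g z\<bar> \<le> ?C"
      using F_bound[OF xy(1)] g_bound[OF xy(2)] g_bound[OF z] xy(3) by linarith
    then show "\<bar>(s + F x + g y - g z)\<^sup>2\<bar> \<le> ?C\<^sup>2"
      using power_mono[of "\<bar>s + F x + g y - g z\<bar>" ?C 2] by simp
  qed
  also have "\<dots> = (\<integral>\<omega>. (D z n \<omega>)\<^sup>2 + h (\<omega> n) \<partial>law_from z)"
  proof (rule Bochner_Integration.integral_cong[OF refl])
    fix \<omega> assume "\<omega> \<in> space (law_from z)"
    then have x: "\<omega> n \<in> space M" by (rule space_law')
    \<comment> \<open>\<open>A\<close> is what is known at time \<open>n\<close>; the new value is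
      \<open>A + g y\<close>, with conditional mean \<open>D z n \<omega>\<close> and conditional
      variance \<open>h (\<omega> n)\<close>.\<close>
    define A where "A = S n \<omega> + F (\<omega> n) - g z"
    interpret Qx: prob_space "Q (\<omega> n)" using prob_algebraD[OF Q_in[OF x]] by simp
    have ig: "integrable (Q (\<omega> n)) g" by (rule integrable_prob_algebra_bounded[OF Q_in[OF x] g_meas g_bound])
    have ig2: "integrable (Q (\<omega> n)) (\<lambda>y. (g y)\<^sup>2)"
      by (rule integrable_prob_algebra_bounded[OF Q_in[OF x] _ g_sq_bound]) measurable
    have "(\<integral>y. (S n \<omega> + F (\<omega> n) + g y - g z)\<^sup>2 \<partial>Q (\<omega> n)) = (\<integral>y. A\<^sup>2 + 2 * A * g y + (g y)\<^sup>2 \<partial>Q (\<omega> n))"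
      by (rule Bochner_Integration.integral_cong[OF refl]) (simp add: A_def power2_eq_square algebra_simps)
    also have "\<dots> = A\<^sup>2 + 2 * A * P 1 g (\<omega> n) + P 1 (\<lambda>y. (g y)\<^sup>2) (\<omega> n)"
      unfolding P_1[OF x] using ig ig2 by (simp add: Qx.prob_space)
    also have "\<dots> = (A + P 1 g (\<omega> n))\<^sup>2 + h (\<omega> n)"
      by (simp add: h_def power2_eq_square algebra_simps)
    also have "A + P 1 g (\<omega> n) = D z n \<omega>" unfolding P_g[OF x] A_def D_def by simp
    finally show "(\<integral>y. (S n \<omega> + F (\<omega> n) + g y - g z)\<^sup>2 \<partial>Q (\<omega> n)) = (D z n \<omega>)\<^sup>2 + h (\<omega> n)" .
  qed
  also have "\<dots> = (\<integral>\<omega>. (D z n \<omega>)\<^sup>2 \<partial>law_from z) + (\<integral>\<omega>. h (\<omega> n) \<partial>law_from z)"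
  proof (rule Bochner_Integration.integral_add)
    show "integrable (law_from z) (\<lambda>\<omega>. (D z n \<omega>)\<^sup>2)"
    proof (rule law_integrable[OF return_in[OF z], of _ "(real n * c + 2 * cg)\<^sup>2"])
      fix \<omega> assume "\<omega> \<in> space (law_from z)"
      from D_bound[OF this, of n] show "\<bar>(D z n \<omega>)\<^sup>2\<bar> \<le> (real n * c + 2 * cg)\<^sup>2"
        using power_mono[of "\<bar>D z n \<omega>\<bar>" "real n * c + 2 * cg" 2] by simp
    qed measurable
    show "integrable (law_from z) (\<lambda>\<omega>. h (\<omega> n))"
      by (rule law_integrable[OF return_in[OF z], of _ "2 * cg\<^sup>2"]) (use h_bound space_law' in auto)
  qed
  also have "(\<integral>\<omega>. h (\<omega> n) \<partial>law_from z) = P n h z"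
    by (rule integral_law_from_component[OF z h_meas h_bound])
  finally show ?case using Suc by simp
qed

end

section \<open>The variance of a block and its corrector\<close>

definition H :: "'a \<Rightarrow> real" where "H z = (\<Sum>k<\<tau>. P k h z)"

text \<open>The corrector: over one block, \<open>H\<close> minus its mean is the expected decrease
  of \<open>G\<close>, as \<open>P_G\<close> records.\<close>

definition G :: "'a \<Rightarrow> real" where "G = poisson \<tau> H"

lemma H_meas[measurable]: "H \<in> borel_measurable M"
  unfolding H_def[abs_def] by measurable

lemma D_\<tau>_bound:
  assumes "z \<in> space M" "\<omega> \<in> space (law_from z)"
  shows "\<bar>D z \<tau> \<omega>\<bar> \<le> b"
proof -
  have "real \<tau> * c + 2 * cg \<le> b" unfolding b_def using c_nonneg by (simp add: field_simps)
  then show ?thesis using D_bound[OF assms, of \<tau>] by linarith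
qed

lemma D_\<tau>_sq_bound:
  assumes "z \<in> space M" "\<omega> \<in> space (law_from z)"
  shows "(D z \<tau> \<omega>)\<^sup>2 \<le> b\<^sup>2"
  using D_\<tau>_bound[OF assms] power_mono[of "\<bar>D z \<tau> \<omega>\<bar>" b 2] by simp

text \<open>As a second moment, \<open>H\<close> lies between 0 and \<open>b\<^sup>2\<close>, of
  order \<tau>^2 c^2. Adding up \<open>h_bound\<close> over the block would only give order \<tau>^3
  c^2.\<close>

lemma H_eq: "z \<in> space M \<Longrightarrow> H z = (\<integral>\<omega>. (D z \<tau> \<omega>)\<^sup>2 \<partial>law_from z)"
  by (simp add: H_def integral_D_sq)

lemma H_nonneg: "z \<in> space M \<Longrightarrow> 0 \<le> H z"
  by (simp add: H_eq)

lemma H_le: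
  assumes z: "z \<in> space M"
  shows "H z \<le> b\<^sup>2"
proof -
  interpret prob_space "law_from z" by (rule prob_space_law[OF return_in[OF z]])
  note [measurable] = D_meas[OF z]
  have i: "integrable (law_from z) (\<lambda>\<omega>. (D z \<tau> \<omega>)\<^sup>2)"
    by (rule law_integrable[OF return_in[OF z], of _ "b\<^sup>2"]) (use D_\<tau>_sq_bound[OF z] in auto)
  show ?thesis unfolding H_eq[OF z]
    by (rule integral_le_const[OF i]) (use D_\<tau>_sq_bound[OF z] in \<open>auto intro: AE_I2\<close>)
qed

lemma integral_H: "(\<integral>z. H z \<partial>\<pi>) = real \<tau> * var"
proof -
  have i: "integrable \<pi> (P k h)" for k
    by (rule integrable_prob_algebra_bounded[OF \<pi>_in P_meas[OF h_meas] P_abs_le[OF h_meas h_bound]])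
  have "(\<integral>z. H z \<partial>\<pi>) = (\<Sum>k<\<tau>. \<integral>z. P k h z \<partial>\<pi>)"
    unfolding H_def using i by (intro Bochner_Integration.integral_sum) auto
  also have "\<dots> = real \<tau> * var"
    by (simp add: integral_P_invariant[OF h_meas h_bound] integral_h)
  finally show ?thesis .
qed

text \<open>The covariance series does not show its sign; the mean of the block variance
  does.\<close>

lemma var_nonneg: "0 \<le> var"
proof -
  have "0 \<le> real \<tau> * var"
    unfolding integral_H[symmetric]
    by (rule integral_prob_algebra_bounds(1)[OF \<pi>_in H_meas H_nonneg H_le])
  then show ?thesis using \<tau> by (simp add: zero_le_mult_iff)
qed

lemma G_meas[measurable]: "G \<in> borel_measurable M"
  unfolding G_def by (rule poisson_meas[OF H_meas H_nonneg H_le sums_div_\<tau>])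

lemma G_bound: "z \<in> space M \<Longrightarrow> \<bar>G z\<bar> \<le> 4 / 3 * b\<^sup>2"
  using poisson_abs_le[OF H_meas H_nonneg H_le sums_div_\<tau>, of z] by (simp add: G_def)

lemma P_G: "z \<in> space M \<Longrightarrow> P \<tau> G z = G z - H z + real \<tau> * var"
  using poisson_equation[OF H_meas H_nonneg H_le sums_div_\<tau>, of z] by (simp only: G_def integral_H)

lemma b_nonneg: "0 \<le> b" using c_nonneg by (simp add: b_def)

end

subsection \<open>Exponential moments\<close>

context ergodic_functional
begin

text \<open>The exponent paid for one block. The number 57 rounds up 512/9, twice the constant in
  the squared bound on the corrector increment.\<close>

definition \<kappa> :: "real \<Rightarrow> real" where
  "\<kappa> \<theta> = 2 * \<theta>\<^sup>2 * (real \<tau> * var) + 57 * \<theta> ^ 4 * b ^ 4"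

text \<open>In the second-order expansion the martingale term has mean 0,
  \<open>2 * (X \<omega>)\<^sup>2\<close> has mean \<open>2 * \<theta>\<^sup>2 * H z\<close>, and
  the corrector has mean \<open>2 * \<theta>\<^sup>2 * (real \<tau> * var - H z)\<close>. So
  \<open>H z\<close> cancels; the factor 2 in front of \<open>G\<close> is chosen for this.\<close>

lemma exp_moment_block:
  assumes z: "z \<in> space M" and \<theta>: "\<bar>\<theta>\<bar> * b \<le> 1 / 4"
  shows "(\<integral>\<^sup>+\<omega>. ennreal (exp (\<theta> * D z \<tau> \<omega> + 2 * \<theta>\<^sup>2 * (G (\<omega> \<tau>) - G z))) \<partial>law_from z)
    \<le> ennreal (exp (\<kappa> \<theta>))"
proof -
  interpret prob_space "law_from z" by (rule prob_space_law[OF return_in[OF z]])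
  note space_law' = law_component[OF return_in[OF z]]
  note [measurable] = law_component_measurable[OF return_in[OF z]] D_meas[OF z]
  define X where "X \<omega> = \<theta> * D z \<tau> \<omega>" for \<omega>
  define R where "R \<omega> = 2 * \<theta>\<^sup>2 * (G (\<omega> \<tau>) - G z)" for \<omega>
  have [measurable]: "X \<in> borel_measurable (law_from z)" "R \<in> borel_measurable (law_from z)"
    unfolding X_def R_def by measurable
  have \<theta>2: "\<theta>\<^sup>2 * b\<^sup>2 \<le> 1 / 16"
    using power_mono[OF \<theta>, of 2] b_nonneg by (simp add: power_mult_distrib power_divide)
  have Xb: "\<bar>X \<omega>\<bar> \<le> 1 / 4" if "\<omega> \<in> space (law_from z)" for \<omega>
    using mult_left_mono[OF D_\<tau>_bound[OF z that], of "\<bar>\<theta>\<bar>"] \<theta> by (simp add: X_def abs_mult)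
  have Rb0: "\<bar>R \<omega>\<bar> \<le> 16 / 3 * (\<theta>\<^sup>2 * b\<^sup>2)" if "\<omega> \<in> space (law_from z)" for \<omega>
  proof -
    have "\<bar>G (\<omega> \<tau>) - G z\<bar> \<le> 8 / 3 * b\<^sup>2"
      using G_bound[OF z] G_bound[OF space_law'[OF that, of \<tau>]] by linarith
    from mult_left_mono[OF this, of "2 * \<theta>\<^sup>2"] show ?thesis by (simp add: R_def abs_mult)
  qed
  \<comment> \<open>Together with \<open>Xb\<close> this keeps the exponent within 7/12 of 0:
    \<open>exp_le_quadratic\<close> applies, and the majorant integrated below is
    nonnegative.\<close>
  have Rb: "\<bar>R \<omega>\<bar> \<le> 1 / 3" if "\<omega> \<in> space (law_from z)" for \<omega>
    using Rb0[OF that] \<theta>2 by linarith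
  have iX: "integrable (law_from z) X" by (rule law_integrable[OF return_in[OF z] _ Xb]) measurable
  have iR: "integrable (law_from z) R" by (rule law_integrable[OF return_in[OF z] _ Rb]) measurable
  have iX2: "integrable (law_from z) (\<lambda>\<omega>. (X \<omega>)\<^sup>2)"
    by (rule law_integrable[OF return_in[OF z], of _ "(1 / 4)\<^sup>2"])
       (use Xb power_mono[of "\<bar>X _\<bar>" "1 / 4" 2] in auto)
  have "exp (X \<omega> + R \<omega>) \<le> 1 + X \<omega> + R \<omega> + 2 * (X \<omega>)\<^sup>2 + 2 * (256 / 9 * (\<theta> ^ 4 * b ^ 4))"
    if \<omega>: "\<omega> \<in> space (law_from z)" for \<omega>
  proof -
    have "(R \<omega>)\<^sup>2 \<le> (16 / 3 * (\<theta>\<^sup>2 * b\<^sup>2))\<^sup>2"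
      using power_mono[OF Rb0[OF \<omega>], of 2] by simp
    also have "\<dots> = 256 / 9 * (\<theta> ^ 4 * b ^ 4)"
      by (simp add: power_mult_distrib power_divide flip: power_mult)
    finally have R2: "(R \<omega>)\<^sup>2 \<le> 256 / 9 * (\<theta> ^ 4 * b ^ 4)" .
    have "exp (X \<omega> + R \<omega>) \<le> 1 + (X \<omega> + R \<omega>) + (X \<omega> + R \<omega>)\<^sup>2"
      using Xb[OF \<omega>] Rb[OF \<omega>] by (intro exp_le_quadratic) linarith
    \<comment> \<open>The factor 2 on the square of \<open>X\<close> is the one that the corrector
      matches; the square of \<open>R\<close> is of fourth order in \<theta> and merely an
      error.\<close>
    also have "(X \<omega> + R \<omega>)\<^sup>2 \<le> 2 * (X \<omega>)\<^sup>2 + 2 * (R \<omega>)\<^sup>2"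
      using zero_le_power2[of "X \<omega> - R \<omega>"] by (simp add: power2_eq_square algebra_simps)
    finally show ?thesis using R2 by linarith
  qed
  then have "(\<integral>\<^sup>+\<omega>. ennreal (exp (X \<omega> + R \<omega>)) \<partial>law_from z) \<le>
    (\<integral>\<^sup>+\<omega>. ennreal (1 + X \<omega> + R \<omega> + 2 * (X \<omega>)\<^sup>2 + 2 * (256 / 9 * (\<theta> ^ 4 * b ^ 4))) \<partial>law_from z)"
    by (intro nn_integral_mono ennreal_leI)
  also have "\<dots> = ennreal (\<integral>\<omega>. 1 + X \<omega> + R \<omega> + 2 * (X \<omega>)\<^sup>2 + 2 * (256 / 9 * (\<theta> ^ 4 * b ^ 4)) \<partial>law_from z)"
  proof (rule nn_integral_eq_integral)
    show "integrable (law_from z) (\<lambda>\<omega>. 1 + X \<omega> + R \<omega> + 2 * (X \<omega>)\<^sup>2 + 2 * (256 / 9 * (\<theta> ^ 4 * b ^ 4)))"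
      using iX iR iX2 by simp
    have "0 \<le> 1 + X \<omega> + R \<omega> + 2 * (X \<omega>)\<^sup>2 + 2 * (256 / 9 * (\<theta> ^ 4 * b ^ 4))"
      if "\<omega> \<in> space (law_from z)" for \<omega>
    proof -
      have "0 \<le> 2 * (X \<omega>)\<^sup>2" "0 \<le> 2 * (256 / 9 * (\<theta> ^ 4 * b ^ 4))" by simp_all
      then show ?thesis using Xb[OF that] Rb[OF that] by linarith
    qed
    then show "AE \<omega> in law_from z. 0 \<le> 1 + X \<omega> + R \<omega> + 2 * (X \<omega>)\<^sup>2 + 2 * (256 / 9 * (\<theta> ^ 4 * b ^ 4))"
      by (rule AE_I2)
  qed
  also have "(\<integral>\<omega>. 1 + X \<omega> + R \<omega> + 2 * (X \<omega>)\<^sup>2 + 2 * (256 / 9 * (\<theta> ^ 4 * b ^ 4)) \<partial>law_from z) =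
    1 + (\<integral>\<omega>. X \<omega> \<partial>law_from z) + (\<integral>\<omega>. R \<omega> \<partial>law_from z) + 2 * (\<integral>\<omega>. (X \<omega>)\<^sup>2 \<partial>law_from z)
      + 2 * (256 / 9 * (\<theta> ^ 4 * b ^ 4))"
    using iX iR iX2 by (simp add: prob_space)
  also have "(\<integral>\<omega>. X \<omega> \<partial>law_from z) = 0"
    unfolding X_def using integral_D[OF z, of \<tau>] by simp
  also have "(\<integral>\<omega>. (X \<omega>)\<^sup>2 \<partial>law_from z) = \<theta>\<^sup>2 * H z"
    unfolding X_def power_mult_distrib H_eq[OF z] by simp
  also have "(\<integral>\<omega>. R \<omega> \<partial>law_from z) = 2 * \<theta>\<^sup>2 * (real \<tau> * var - H z)"
  proof -
    have iG: "integrable (law_from z) (\<lambda>\<omega>. G (\<omega> \<tau>))"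
      by (rule law_integrable[OF return_in[OF z], of _ "4 / 3 * b\<^sup>2"]) (use G_bound space_law' in auto)
    have "(\<integral>\<omega>. R \<omega> \<partial>law_from z) = 2 * \<theta>\<^sup>2 * ((\<integral>\<omega>. G (\<omega> \<tau>) \<partial>law_from z) - G z)"
      unfolding R_def using iG by (simp add: prob_space)
    also have "(\<integral>\<omega>. G (\<omega> \<tau>) \<partial>law_from z) = P \<tau> G z"
      by (rule integral_law_from_component[OF z G_meas G_bound])
    finally show ?thesis by (simp add: P_G[OF z])
  qed
  finally have le: "(\<integral>\<^sup>+\<omega>. ennreal (exp (X \<omega> + R \<omega>)) \<partial>law_from z) \<le>
    ennreal (1 + 0 + 2 * \<theta>\<^sup>2 * (real \<tau> * var - H z) + 2 * (\<theta>\<^sup>2 * H z) + 2 * (256 / 9 * (\<theta> ^ 4 * b ^ 4)))" .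
  have "0 \<le> \<theta> ^ 4 * b ^ 4" by simp
  then have "1 + 0 + 2 * \<theta>\<^sup>2 * (real \<tau> * var - H z) + 2 * (\<theta>\<^sup>2 * H z) + 2 * (256 / 9 * (\<theta> ^ 4 * b ^ 4)) \<le> 1 + \<kappa> \<theta>"
    by (simp add: \<kappa>_def algebra_simps)
  also have "\<dots> \<le> exp (\<kappa> \<theta>)" by (rule exp_ge_add_one_self)
  finally show ?thesis using le unfolding X_def R_def by (meson ennreal_leI order_trans)
qed

text \<open>\<open>cg\<close> is 8/21 of \<open>b\<close>, so the two terms are at most 2/21 and
  1/6.\<close>

lemma correctors_small:
  assumes z: "z \<in> space M" and \<theta>: "\<bar>\<theta>\<bar> * b \<le> 1 / 4"
  shows "\<bar>\<theta> * g z + 2 * \<theta>\<^sup>2 * G z\<bar> \<le> 1 / 3"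
proof -
  have \<theta>2: "\<theta>\<^sup>2 * b\<^sup>2 \<le> 1 / 16"
    using power_mono[OF \<theta>, of 2] b_nonneg by (simp add: power_mult_distrib power_divide)
  have "\<bar>\<theta> * g z\<bar> \<le> \<bar>\<theta>\<bar> * (8 / 21 * b)"
    unfolding abs_mult using g_bound[OF z] by (intro mult_left_mono) (simp_all add: b_def algebra_simps)
  moreover have "\<bar>2 * \<theta>\<^sup>2 * G z\<bar> \<le> 2 * \<theta>\<^sup>2 * (4 / 3 * b\<^sup>2)"
    using mult_left_mono[OF G_bound[OF z], of "2 * \<theta>\<^sup>2"] by (simp add: abs_mult)
  ultimately show ?thesis using \<theta> \<theta>2 by linarith
qed

text \<open>Each block is conditioned on its starting state. The boundary terms telescope, and those
  at time 0 cost the 1/3.\<close>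

lemma exp_moment_blocks:
  assumes \<xi>: "\<xi> \<in> space (prob_algebra M)" and \<theta>: "\<bar>\<theta>\<bar> * b \<le> 1 / 4"
  shows "(\<integral>\<^sup>+\<omega>. ennreal (exp (\<theta> * (S (k * \<tau>) \<omega> + g (\<omega> (k * \<tau>))) + 2 * \<theta>\<^sup>2 * G (\<omega> (k * \<tau>)))) \<partial>law \<xi>)
    \<le> ennreal (exp (real k * \<kappa> \<theta> + 1 / 3))"
proof (induction k)
  interpret prob_space "law \<xi>" by (rule prob_space_law[OF \<xi>])
  case 0
  have "(\<integral>\<^sup>+\<omega>. ennreal (exp (\<theta> * g (\<omega> 0) + 2 * \<theta>\<^sup>2 * G (\<omega> 0))) \<partial>law \<xi>) \<le> (\<integral>\<^sup>+\<omega>. ennreal (exp (1 / 3)) \<partial>law \<xi>)"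
  proof (intro nn_integral_mono ennreal_leI)
    fix \<omega> assume "\<omega> \<in> space (law \<xi>)"
    from correctors_small[OF law_component[OF \<xi> this] \<theta>, of 0]
    show "exp (\<theta> * g (\<omega> 0) + 2 * \<theta>\<^sup>2 * G (\<omega> 0)) \<le> exp (1 / 3)" by (subst exp_le_cancel_iff) linarith
  qed
  then show ?case by (simp add: emeasure_space_1)
next
  case (Suc k)
  define W where "W x s = ennreal (exp (\<theta> * (s + g x) + 2 * \<theta>\<^sup>2 * G x))" for x s
  have W: "(\<lambda>(x, s). W x s) \<in> borel_measurable (M \<Otimes>\<^sub>M borel)"
    unfolding W_def split_beta' by measurable
  note [measurable] = law_component_measurable[OF \<xi>] law_S_measurable[OF \<xi>]
  have "(\<integral>\<^sup>+\<omega>. W (\<omega> (Suc k * \<tau>)) (S (Suc k * \<tau>) \<omega>) \<partial>law \<xi>) =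
    (\<integral>\<^sup>+\<omega>. (\<integral>\<^sup>+\<omega>'. W (\<omega>' \<tau>) (S (k * \<tau>) \<omega> + S \<tau> \<omega>') \<partial>law_from (\<omega> (k * \<tau>))) \<partial>law \<xi>)"
    using nn_integral_markov[OF \<xi> W, of "k * \<tau>" \<tau>] by (simp add: add.commute)
  also have "\<dots> \<le> (\<integral>\<^sup>+\<omega>. ennreal (exp (\<kappa> \<theta>)) * W (\<omega> (k * \<tau>)) (S (k * \<tau>) \<omega>) \<partial>law \<xi>)"
  proof (rule nn_integral_mono)
    fix \<omega> assume "\<omega> \<in> space (law \<xi>)"
    then have x: "\<omega> (k * \<tau>) \<in> space M" using law_component[OF \<xi>] by simp
    let ?x = "\<omega> (k * \<tau>)" and ?s = "S (k * \<tau>) \<omega>"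
    note [measurable] = law_component_measurable[OF return_in[OF x]] D_meas[OF x]
    have "(\<integral>\<^sup>+\<omega>'. W (\<omega>' \<tau>) (?s + S \<tau> \<omega>') \<partial>law_from ?x) =
      (\<integral>\<^sup>+\<omega>'. W ?x ?s * ennreal (exp (\<theta> * D ?x \<tau> \<omega>' + 2 * \<theta>\<^sup>2 * (G (\<omega>' \<tau>) - G ?x))) \<partial>law_from ?x)"
      by (intro nn_integral_cong)
         (simp add: W_def D_def algebra_simps flip: ennreal_mult' exp_add)
    also have "\<dots> = W ?x ?s *
      (\<integral>\<^sup>+\<omega>'. ennreal (exp (\<theta> * D ?x \<tau> \<omega>' + 2 * \<theta>\<^sup>2 * (G (\<omega>' \<tau>) - G ?x))) \<partial>law_from ?x)"
      by (rule nn_integral_cmult) measurable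
    also have "\<dots> \<le> W ?x ?s * ennreal (exp (\<kappa> \<theta>))"
      by (intro mult_left_mono exp_moment_block[OF x \<theta>]) simp
    finally show "(\<integral>\<^sup>+\<omega>'. W (\<omega>' \<tau>) (?s + S \<tau> \<omega>') \<partial>law_from ?x) \<le> ennreal (exp (\<kappa> \<theta>)) * W ?x ?s"
      by (simp add: mult.commute)
  qed
  also have "\<dots> = ennreal (exp (\<kappa> \<theta>)) * (\<integral>\<^sup>+\<omega>. W (\<omega> (k * \<tau>)) (S (k * \<tau>) \<omega>) \<partial>law \<xi>)"
    unfolding W_def by (rule nn_integral_cmult) measurable
  also have "\<dots> \<le> ennreal (exp (\<kappa> \<theta>)) * ennreal (exp (real k * \<kappa> \<theta> + 1 / 3))"
    unfolding W_def by (intro mult_left_mono Suc) simp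
  also have "\<dots> = ennreal (exp (real (Suc k) * \<kappa> \<theta> + 1 / 3))"
    by (simp add: algebra_simps flip: ennreal_mult' exp_add)
  finally show ?case by (simp add: W_def)
qed

text \<open>The incomplete last block contributes at most |\<theta>| b / 7 \<le> 1/28 and removing
  the boundary terms at most 1/3, together less than 1/2. With the 1/3 from time 0 the total stays
  below 1.\<close>

lemma exp_moment:
  assumes \<xi>: "\<xi> \<in> space (prob_algebra M)" and \<theta>: "\<bar>\<theta>\<bar> * b \<le> 1 / 4"
  shows "(\<integral>\<^sup>+\<omega>. ennreal (exp (\<theta> * S n \<omega>)) \<partial>law \<xi>) \<le> ennreal (exp (real (n div \<tau>) * \<kappa> \<theta> + 1))"
proof -
  define k where "k = n div \<tau>"
  define r where "r = n mod \<tau>"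
  have n: "n = k * \<tau> + r" and r: "r \<le> \<tau>"
    using \<tau> by (auto simp: k_def r_def intro: less_imp_le)
  note [measurable] = law_component_measurable[OF \<xi>] law_S_measurable[OF \<xi>]
  let ?E = "\<lambda>\<omega>. exp (\<theta> * (S (k * \<tau>) \<omega> + g (\<omega> (k * \<tau>))) + 2 * \<theta>\<^sup>2 * G (\<omega> (k * \<tau>)))"
  have "(\<integral>\<^sup>+\<omega>. ennreal (exp (\<theta> * S n \<omega>)) \<partial>law \<xi>) \<le> (\<integral>\<^sup>+\<omega>. ennreal (exp (1 / 2)) * ennreal (?E \<omega>) \<partial>law \<xi>)"
  proof (rule nn_integral_mono)
    fix \<omega> assume \<omega>: "\<omega> \<in> space (law \<xi>)"
    have "\<bar>\<theta> * (S n \<omega> - S (k * \<tau>) \<omega>)\<bar> \<le> \<bar>\<theta>\<bar> * (real \<tau> * c)"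
      unfolding abs_mult n using S_diff_bound[OF \<xi> \<omega>, of "k * \<tau>" r] r c_nonneg
      by (intro mult_left_mono) (auto intro: order_trans[OF _ mult_right_mono])
    also have "\<dots> = \<bar>\<theta>\<bar> * b / 7" by (simp add: b_def)
    finally have "\<theta> * S n \<omega> \<le> 1 / 2 + (\<theta> * (S (k * \<tau>) \<omega> + g (\<omega> (k * \<tau>))) + 2 * \<theta>\<^sup>2 * G (\<omega> (k * \<tau>)))"
      using \<theta> correctors_small[OF law_component[OF \<xi> \<omega>, of "k * \<tau>"] \<theta>] unfolding right_diff_distrib distrib_left by linarith
    then show "ennreal (exp (\<theta> * S n \<omega>)) \<le> ennreal (exp (1 / 2)) * ennreal (?E \<omega>)"
      by (simp flip: ennreal_mult' exp_add)
  qed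
  also have "\<dots> = ennreal (exp (1 / 2)) * (\<integral>\<^sup>+\<omega>. ennreal (?E \<omega>) \<partial>law \<xi>)"
    by (rule nn_integral_cmult) measurable
  also have "\<dots> \<le> ennreal (exp (1 / 2)) * ennreal (exp (real k * \<kappa> \<theta> + 1 / 3))"
    by (intro mult_left_mono exp_moment_blocks[OF \<xi> \<theta>]) simp
  also have "\<dots> \<le> ennreal (exp (real k * \<kappa> \<theta> + 1))"
    by (simp flip: ennreal_mult' exp_add)
  finally show ?thesis by (simp add: k_def)
qed

end

text \<open>The function |x|^p exp(-\<theta> |x|) is largest at |x| = p/\<theta>. This bounds |x|^p
  pointwise by the two exponentials.\<close>

lemma moment_root_le_of_exp_moments:
  fixes X :: "'a \<Rightarrow> real"
  assumes [measurable]: "X \<in> borel_measurable N" and p: "2 \<le> p" and \<theta>: "0 < \<theta>"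
    and e: "(\<integral>\<^sup>+\<omega>. ennreal (exp (\<theta> * X \<omega>)) \<partial>N) \<le> ennreal (exp (L + 1))"
      "(\<integral>\<^sup>+\<omega>. ennreal (exp (- \<theta> * X \<omega>)) \<partial>N) \<le> ennreal (exp (L + 1))"
  shows "moment_root N p X \<le> p / \<theta> * exp (L / p)"
proof -
  let ?A = "(p / \<theta>) powr p * exp (- p)"
  have pointwise: "\<bar>x\<bar> powr p \<le> ?A * exp (\<theta> * x) + ?A * exp (- \<theta> * x)" for x :: real
  proof (cases "x = 0")
    case False
    \<comment> \<open>In this scale the maximiser is 1, and the pointwise bound becomes ln y \<le> y
      - 1.\<close>
    define y where "y = \<theta> * \<bar>x\<bar> / p"
    have y: "0 < y" using False \<theta> p by (simp add: y_def)
    have "\<bar>x\<bar> = (p / \<theta>) * y" using \<theta> p by (simp add: y_def)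
    then have eq: "\<bar>x\<bar> powr p = (p / \<theta>) powr p * y powr p"
      using y \<theta> p by (simp only: powr_mult)
    have "y powr p = exp (p * ln y)" using y by (simp add: powr_def)
    also have "\<dots> \<le> exp (p * (y - 1))"
      using ln_le_minus_one[OF y] p by simp
    also have "p * (y - 1) = - p + \<theta> * \<bar>x\<bar>" using p by (simp add: y_def field_simps)
    finally have "y powr p \<le> exp (- p) * exp (\<theta> * \<bar>x\<bar>)" by (simp only: exp_add)
    then have "\<bar>x\<bar> powr p \<le> ?A * exp (\<theta> * \<bar>x\<bar>)"
      unfolding eq mult.assoc by (rule mult_left_mono) simp
    also have "\<dots> \<le> ?A * (exp (\<theta> * x) + exp (- \<theta> * x))"
      by (intro mult_left_mono) (auto simp: abs_if)
    finally show ?thesis by (simp add: algebra_simps)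
  qed simp
  have A: "0 \<le> ?A" by simp
  have "(\<integral>\<^sup>+\<omega>. ennreal (\<bar>X \<omega>\<bar> powr p) \<partial>N) \<le>
    (\<integral>\<^sup>+\<omega>. ennreal ?A * ennreal (exp (\<theta> * X \<omega>)) + ennreal ?A * ennreal (exp (- \<theta> * X \<omega>)) \<partial>N)"
    using pointwise A by (intro nn_integral_mono) (simp flip: ennreal_mult ennreal_plus)
  also have "\<dots> = ennreal ?A * (\<integral>\<^sup>+\<omega>. ennreal (exp (\<theta> * X \<omega>)) \<partial>N) +
    ennreal ?A * (\<integral>\<^sup>+\<omega>. ennreal (exp (- \<theta> * X \<omega>)) \<partial>N)"
    by (simp add: nn_integral_add nn_integral_cmult)
  also have "\<dots> \<le> ennreal ?A * ennreal (exp (L + 1)) + ennreal ?A * ennreal (exp (L + 1))"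
    by (intro add_mono mult_left_mono e) auto
  also have "\<dots> = ennreal (?A * exp (L + 1) + ?A * exp (L + 1))"
    using A by (simp flip: ennreal_mult ennreal_plus)
  finally have "(\<integral>\<omega>. \<bar>X \<omega>\<bar> powr p \<partial>N) \<le> ?A * exp (L + 1) + ?A * exp (L + 1)"
    by (intro integral_real_bounded) auto
  also have "\<dots> = (p / \<theta>) powr p * (2 * exp (1 - p) * exp L)"
    by (simp add: exp_add exp_diff exp_minus field_simps)
  \<comment> \<open>The factor 2 exp(1 - p) is at most 2/e, hence at most 1, since \<open>p\<close>
    is at least 2.\<close>
  also have "\<dots> \<le> (p / \<theta>) powr p * (1 * exp L)"
  proof -
    have "exp (1 - p) \<le> exp (- 1)" using p by simp
    moreover have "2 \<le> exp (1::real)" using exp_ge_add_one_self[of 1] by simp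
    ultimately have "2 * exp (1 - p) \<le> exp 1 * exp (- 1)" by (intro mult_mono) auto
    then have "2 * exp (1 - p) \<le> 1" by (simp flip: exp_add)
    then show ?thesis by (intro mult_left_mono mult_right_mono) auto
  qed
  also have "\<dots> = (p / \<theta> * exp (L / p)) powr p"
  proof -
    have "exp (L / p) powr p = exp L" using p by (simp add: powr_def)
    then show ?thesis by (simp only: powr_mult mult_1)
  qed
  finally have "(\<integral>\<omega>. \<bar>X \<omega>\<bar> powr p \<partial>N) powr (1 / p) \<le> ((p / \<theta> * exp (L / p)) powr p) powr (1 / p)"
    using p by (intro powr_mono2) (auto intro!: integral_nonneg_AE)
  also have "\<dots> = p / \<theta> * exp (L / p)" using p \<theta> by (simp add: powr_powr)
  finally show ?thesis by (simp add: moment_root_def)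
qed

section \<open>Choice of the exponential parameter\<close>

context ergodic_functional
begin

lemma moment_bound:
  assumes \<xi>: "\<xi> \<in> space (prob_algebra M)" and p: "2 \<le> p" and c: "0 < c"
  shows "moment_root (law \<xi>) p (S n) \<le>
    exp 3 * (sqrt p * sqrt (real n) * sqrt var
      + 21 * c * p * (real n powr (1 / 4) * real \<tau> powr (3 / 4)) + 28 * real \<tau> * c * p)"
proof -
  define q where "q = (real n / (real \<tau> * p)) powr (1 / 4)"
  define a1 where "a1 = sqrt (real n * var / p)"
  \<comment> \<open>\<open>T\<close> is the inverse of \<theta> and has one summand per constraint:
    \<open>a1\<close> gives \<theta>^2 n var \<le> p, \<open>3 * b * q\<close> gives 81 \<theta>^4
    b^4 n/\<tau> \<le> p, and \<open>4 * b\<close> gives |\<theta>| b \<le> 1/4. The three summands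
    become the three terms of the claim.\<close>
  define T where "T = a1 + 3 * b * q + 4 * b"
  define \<theta> where "\<theta> = 1 / T"
  have b: "0 < b" using c \<tau> by (simp add: b_def)
  have q: "0 \<le> q" by (simp add: q_def)
  have a1: "0 \<le> a1" using var_nonneg p by (simp add: a1_def)
  have bq: "0 \<le> b * q" using b q by simp
  have T4: "4 * b \<le> T" and T1: "a1 \<le> T" and T3: "3 * b * q \<le> T"
    using a1 bq b by (auto simp: T_def)
  have T: "0 < T" using T4 b by linarith
  have \<theta>: "0 < \<theta>" "\<bar>\<theta>\<bar> * b \<le> 1 / 4" "\<bar>- \<theta>\<bar> * b \<le> 1 / 4" using T T4 by (auto simp: \<theta>_def field_simps)
  have "(real n * var / p) \<le> T\<^sup>2"
    using power_mono[OF T1 a1, of 2] var_nonneg p by (simp add: a1_def)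
  then have v: "\<theta>\<^sup>2 * (real n * var) \<le> p"
    using T p by (simp add: \<theta>_def field_simps power_divide)
  have q4: "q ^ 4 = real n / (real \<tau> * p)"
  proof -
    have "q ^ 4 = q powr 4" using q by simp
    also have "\<dots> = (real n / (real \<tau> * p)) powr 1" unfolding q_def powr_powr by simp
    finally show ?thesis using p by simp
  qed
  have "(3 * b * q) ^ 4 \<le> T ^ 4" using T3 b q by (intro power_mono) auto
  then have "81 * b ^ 4 * (real n / (real \<tau> * p)) \<le> T ^ 4"
    by (simp add: power_mult_distrib q4)
  then have w: "81 * (\<theta> ^ 4 * b ^ 4 * (real n / real \<tau>)) \<le> p"
    using T p \<tau> by (simp add: \<theta>_def field_simps power_divide)
  define k where "k = n div \<tau>"
  have k: "real k * real \<tau> \<le> real n" by (simp add: k_def flip: of_nat_mult)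
  have k': "real k \<le> real n / real \<tau>" using k \<tau> by (simp add: field_simps)
  have "real k * \<kappa> \<theta> = 2 * (\<theta>\<^sup>2 * (real k * real \<tau> * var)) + 57 * (\<theta> ^ 4 * b ^ 4 * real k)"
    by (simp add: \<kappa>_def algebra_simps)
  also have "\<dots> \<le> 2 * (\<theta>\<^sup>2 * (real n * var)) + 57 * (\<theta> ^ 4 * b ^ 4 * (real n / real \<tau>))"
    using k k' var_nonneg b by (intro add_mono mult_left_mono mult_right_mono) auto
  \<comment> \<open>2 + 57/81 is below 3; after division by \<open>p\<close> this is the factor
    \<open>exp 3\<close>.\<close>
  also have "\<dots> \<le> 3 * p" using v w p by linarith
  finally have L: "real k * \<kappa> \<theta> \<le> 3 * p" .
  have "moment_root (law \<xi>) p (S n) \<le> p / \<theta> * exp (3 * p / p)"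
  proof (rule moment_root_le_of_exp_moments[OF law_S_measurable[OF \<xi>] p \<theta>(1)])
    have le: "ennreal (exp (real k * \<kappa> \<theta> + 1)) \<le> ennreal (exp (3 * p + 1))" using L by (intro ennreal_leI) simp
    show "(\<integral>\<^sup>+\<omega>. ennreal (exp (\<theta> * S n \<omega>)) \<partial>law \<xi>) \<le> ennreal (exp (3 * p + 1))"
      using exp_moment[OF \<xi> \<theta>(2), of n] le unfolding k_def by (rule order_trans)
    have "\<kappa> (- \<theta>) = \<kappa> \<theta>" by (simp add: \<kappa>_def)
    then show "(\<integral>\<^sup>+\<omega>. ennreal (exp (- \<theta> * S n \<omega>)) \<partial>law \<xi>) \<le> ennreal (exp (3 * p + 1))"
      using order_trans[OF exp_moment[OF \<xi> \<theta>(3), of n]] le by (simp only: k_def)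
  qed
  also have "p / \<theta> * exp (3 * p / p) = exp 3 * (p * T)" using p by (simp add: \<theta>_def)
  also have "\<dots> \<le> exp 3 * (sqrt p * sqrt (real n) * sqrt var
      + 21 * c * p * (real n powr (1 / 4) * real \<tau> powr (3 / 4)) + 28 * real \<tau> * c * p)"
  proof (rule mult_left_mono)
    have "p * a1 = (p / sqrt p) * (sqrt (real n) * sqrt var)"
      by (simp add: a1_def real_sqrt_mult real_sqrt_divide)
    also have "p / sqrt p = sqrt p" using p by (intro real_div_sqrt) simp
    finally have e1: "p * a1 = sqrt p * sqrt (real n) * sqrt var" by simp
    \<comment> \<open>Giving up p^(-1/4) here turns p^(3/4) into the factor \<open>p\<close> of the
      middle term.\<close>
    have "q \<le> (real n / real \<tau>) powr (1 / 4)"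
      unfolding q_def using p \<tau> mult_right_mono[of 1 p "real n"]
      by (intro powr_mono2) (auto simp: field_simps)
    also have "\<dots> = real n powr (1 / 4) / real \<tau> powr (1 / 4)" by (simp add: powr_divide)
    finally have "real \<tau> * q \<le> real \<tau> * (real n powr (1 / 4) / real \<tau> powr (1 / 4))"
      by (intro mult_left_mono) auto
    also have "\<dots> = real n powr (1 / 4) * real \<tau> powr (3 / 4)"
      using \<tau> powr_diff[of "real \<tau>" 1 "1 / 4"] by simp
    finally have "21 * c * p * (real \<tau> * q) \<le> 21 * c * p * (real n powr (1 / 4) * real \<tau> powr (3 / 4))"
      using c p by (intro mult_left_mono) auto
    then show "p * T \<le> sqrt p * sqrt (real n) * sqrt var
      + 21 * c * p * (real n powr (1 / 4) * real \<tau> powr (3 / 4)) + 28 * real \<tau> * c * p"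
      unfolding T_def distrib_left e1 by (simp add: b_def algebra_simps)
  qed simp
  finally show ?thesis .
qed

end

subsection \<open>Dependence on the initial law\<close>

lemma powr_convex_comb_le:
  fixes t w p :: real
  assumes t: "0 \<le> t" "t \<le> 1" and w: "0 \<le> w" and p: "1 \<le> p"
  shows "(t + (1 - t) * w) powr p \<le> t + (1 - t) * w powr p"
proof (cases "w = 0")
  case True
  show ?thesis
  proof (cases "t = 0")
    case False
    then have "t powr p \<le> t" using t p by (intro powr_le_one_le) auto
    then show ?thesis using True by simp
  qed (use True in simp)
next
  case False
  then have "((1 - t) *\<^sub>R w + t *\<^sub>R 1) powr p \<le> (1 - t) * w powr p + t * 1 powr p"
    using t w by (intro convex_onD[OF powr_convex[OF p]]) auto
  then show ?thesis by (simp add: algebra_simps)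
qed

lemma moment_root_nonneg[simp]: "0 \<le> moment_root N p X"
  by (simp add: moment_root_def)

lemma moment_root_powr:
  assumes "p \<noteq> 0"
  shows "moment_root N p X powr p = (\<integral>\<omega>. \<bar>X \<omega>\<bar> powr p \<partial>N)"
proof -
  have "0 \<le> (\<integral>\<omega>. \<bar>X \<omega>\<bar> powr p \<partial>N)" by (rule Bochner_Integration.integral_nonneg) simp
  then show ?thesis using assms by (simp add: moment_root_def powr_powr)
qed

text \<open>Minkowski's inequality with one constant summand. With \<open>y\<close> just above the
  norm of \<open>U\<close>, the sum a + |U| is a + y times a convex combination of 1 and |U|/y;
  convexity of the power is then integrated.\<close>

lemma moment_root_le_const_add:
  fixes U V :: "'a \<Rightarrow> real"
  assumes "prob_space N" and p: "1 \<le> p" and a: "0 \<le> a"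
    and [measurable]: "U \<in> borel_measurable N" "V \<in> borel_measurable N"
    and bU: "\<And>\<omega>. \<omega> \<in> space N \<Longrightarrow> \<bar>U \<omega>\<bar> \<le> C"
    and le: "\<And>\<omega>. \<omega> \<in> space N \<Longrightarrow> \<bar>V \<omega>\<bar> \<le> a + \<bar>U \<omega>\<bar>"
  shows "moment_root N p V \<le> a + moment_root N p U"
proof (rule field_le_epsilon)
  fix e :: real assume e: "0 < e"
  interpret prob_space N by fact
  \<comment> \<open>The slack \<open>e\<close> keeps \<open>y\<close> positive even when the norm of
    \<open>U\<close> is 0.\<close>
  define y where "y = moment_root N p U + e"
  have y: "0 < y" using moment_root_nonneg[of N p U] e by (simp add: y_def add_nonneg_pos)
  define t where "t = a / (a + y)"
  have t: "0 \<le> t" "t \<le> 1" using a y by (auto simp: t_def)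
  have iU: "integrable N (\<lambda>\<omega>. \<bar>U \<omega>\<bar> powr p)"
    using bU p by (intro integrable_const_bound[where B = "C powr p"] AE_I2) (auto intro!: powr_mono2)
  have "\<bar>V \<omega>\<bar> powr p \<le> (a + y) powr p * (t + (1 - t) * (\<bar>U \<omega>\<bar> powr p / y powr p))"
    if \<omega>: "\<omega> \<in> space N" for \<omega>
  proof -
    have "a + \<bar>U \<omega>\<bar> = (a + y) * (t + (1 - t) * (\<bar>U \<omega>\<bar> / y))"
    proof -
      have "(a + y) * t = a" "(a + y) * (1 - t) = y" using a y by (auto simp: t_def field_simps)
      then have "(a + y) * t + (a + y) * (1 - t) * (\<bar>U \<omega>\<bar> / y) = a + y * (\<bar>U \<omega>\<bar> / y)" by (simp only:)
      then show ?thesis using y by (simp add: distrib_left mult.assoc)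
    qed
    then have "\<bar>V \<omega>\<bar> powr p \<le> ((a + y) * (t + (1 - t) * (\<bar>U \<omega>\<bar> / y))) powr p"
      using le[OF \<omega>] p by (intro powr_mono2) auto
    also have "\<dots> = (a + y) powr p * (t + (1 - t) * (\<bar>U \<omega>\<bar> / y)) powr p"
      using a y t by (intro powr_mult)
    also have "\<dots> \<le> (a + y) powr p * (t + (1 - t) * (\<bar>U \<omega>\<bar> / y) powr p)"
      using y by (intro mult_left_mono powr_convex_comb_le[OF t _ p]) auto
    also have "(\<bar>U \<omega>\<bar> / y) powr p = \<bar>U \<omega>\<bar> powr p / y powr p" using y by (simp add: powr_divide)
    finally show ?thesis .
  qed
  moreover have "integrable N (\<lambda>\<omega>. \<bar>V \<omega>\<bar> powr p)"
  proof (rule integrable_const_bound[where B = "(a + C) powr p"])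
    show "AE \<omega> in N. norm (\<bar>V \<omega>\<bar> powr p) \<le> (a + C) powr p"
    proof (rule AE_I2)
      fix \<omega> assume "\<omega> \<in> space N"
      from le[OF this] bU[OF this] show "norm (\<bar>V \<omega>\<bar> powr p) \<le> (a + C) powr p"
        using p by (auto intro!: powr_mono2)
    qed
  qed measurable
  ultimately have "(\<integral>\<omega>. \<bar>V \<omega>\<bar> powr p \<partial>N) \<le>
    (\<integral>\<omega>. (a + y) powr p * (t + (1 - t) * (\<bar>U \<omega>\<bar> powr p / y powr p)) \<partial>N)"
    using iU by (intro integral_mono) auto
  also have "\<dots> = (a + y) powr p * (t + (1 - t) * ((\<integral>\<omega>. \<bar>U \<omega>\<bar> powr p \<partial>N) / y powr p))"
    using iU by (simp add: prob_space)
  also have "\<dots> \<le> (a + y) powr p * (t + (1 - t) * 1)"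
  proof -
    have "(\<integral>\<omega>. \<bar>U \<omega>\<bar> powr p \<partial>N) = moment_root N p U powr p" using p by (simp add: moment_root_powr)
    also have "\<dots> \<le> y powr p"
      using p e moment_root_nonneg by (intro powr_mono2) (auto simp: y_def)
    finally show ?thesis using t y by (intro mult_left_mono add_left_mono) auto
  qed
  finally have "(\<integral>\<omega>. \<bar>V \<omega>\<bar> powr p \<partial>N) powr (1 / p) \<le> ((a + y) powr p) powr (1 / p)"
    using p by (intro powr_mono2) (auto intro: Bochner_Integration.integral_nonneg)
  then show "moment_root N p V \<le> a + moment_root N p U + e"
    using p a y by (simp add: moment_root_def powr_powr y_def)
qed

lemma powr_above_tangent:
  fixes x y p :: real
  assumes "1 \<le> p" "0 < x" "0 < y"
  shows "p * y powr (p - 1) * (x - y) \<le> x powr p - y powr p"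
  using assms
  by (intro convex_on_imp_above_tangent[OF powr_convex[of p]])
     (auto intro!: derivative_eq_intros simp: interior_open)

text \<open>After division by the sum, both bases lie in [0,1], where the power only decreases
  them.\<close>

lemma powr_superadditive:
  fixes x y p :: real
  assumes p: "1 \<le> p" and "0 \<le> x" "0 \<le> y"
  shows "x powr p + y powr p \<le> (x + y) powr p"
proof (cases "x = 0 \<or> y = 0")
  case False
  then have xy: "0 < x" "0 < y" using assms by auto
  define s where "s = x + y"
  have s: "0 < s" using xy by (simp add: s_def)
  have "(x / s) powr p \<le> x / s" "(y / s) powr p \<le> y / s"
    using xy s p by (auto intro!: powr_le_one_le simp: s_def)
  moreover have "x / s + y / s = 1" using s by (simp add: s_def flip: add_divide_distrib)
  ultimately have "(x / s) powr p + (y / s) powr p \<le> 1" by linarith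
  then have "(x powr p + y powr p) / s powr p \<le> 1"
    using xy s by (simp add: powr_divide add_divide_distrib)
  then show ?thesis using s by (simp add: s_def field_simps)
qed (use assms in auto)

text \<open>If \<open>U\<close> and \<open>L\<close> are comparable, \<open>x \<mapsto> x powr p\<close> has comparable slopes on \<open>[L, U]\<close>; otherwise
  \<open>U - L\<close> is of the order of \<open>U\<close>.\<close>
lemma powr_contraction:
  fixes x y L U p \<epsilon> :: real
  assumes p: "1 \<le> p" and L: "0 \<le> L" and LU: "L \<le> U" and x: "L \<le> x" and y: "y \<le> U"
    and le: "y powr p \<le> x powr p + \<epsilon> * (U powr p - L powr p)"
    and \<epsilon>: "0 \<le> \<epsilon>" "\<epsilon> \<le> (1 / 4) powr p"
  shows "y \<le> x + (U - L) / 2"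
proof (cases "y \<le> x")
  case True
  then show ?thesis using LU by argo
next
  case False
  then have xy: "x < y" by simp
  then have LU: "L < U" and U: "0 < U" and y0: "0 < y" using x y L by linarith+
  show ?thesis
  proof (cases "U \<le> 2 * L")
    case True
    then have L0: "0 < L" using U by linarith
    have "p * L powr (p - 1) * (y - x) \<le> p * x powr (p - 1) * (y - x)"
      using p L x xy by (intro mult_right_mono mult_left_mono powr_mono2) auto
    also have "\<dots> \<le> y powr p - x powr p"
      using p L0 x y0 by (intro powr_above_tangent) auto
    also have "\<dots> \<le> \<epsilon> * (U powr p - L powr p)" using le by linarith
    also have "\<dots> \<le> \<epsilon> * (p * U powr (p - 1) * (U - L))"
      using powr_above_tangent[OF p L0 U] \<epsilon> by (intro mult_left_mono) (auto simp: algebra_simps)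
    also have "\<dots> \<le> \<epsilon> * (p * (2 * L) powr (p - 1) * (U - L))"
      using \<epsilon> p True LU U by (intro mult_left_mono mult_right_mono powr_mono2) auto
    also have "\<dots> = p * L powr (p - 1) * (\<epsilon> * 2 powr (p - 1) * (U - L))"
      using L0 by (simp add: powr_mult)
    finally have 1: "y - x \<le> \<epsilon> * 2 powr (p - 1) * (U - L)"
      using p L0 by simp
    \<comment> \<open>The ratio of slopes costs 2^(p-1), which \<epsilon> \<le> 4^(-p) outweighs:
      the product is at most 2^(-p) \<le> 1/2.\<close>
    have "\<epsilon> * 2 powr (p - 1) \<le> (1 / 4) powr p * 2 powr p"
      using \<epsilon> by (intro mult_mono) auto
    also have "\<dots> = (1 / 2) powr p" by (simp flip: powr_mult)
    also have "\<dots> \<le> (1 / 2) powr 1" using p by (intro powr_mono') auto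
    finally have "\<epsilon> * 2 powr (p - 1) * (U - L) \<le> 1 / 2 * (U - L)"
      using LU by (intro mult_right_mono) auto
    with 1 show ?thesis by linarith
  next
    case False
    \<comment> \<open>Here \<open>U - L\<close> exceeds \<open>U / 2\<close>, so the bound
      \<open>U / 4\<close> on \<open>y - x\<close> obtained from superadditivity is enough.\<close>
    have "(y - x) powr p \<le> y powr p - x powr p"
      using powr_superadditive[OF p, of "y - x" x] xy x L by auto
    also have "\<dots> \<le> \<epsilon> * (U powr p - L powr p)" using le by linarith
    also have "\<dots> \<le> (1 / 4) powr p * U powr p"
      using \<epsilon> LU L p by (intro mult_mono) (auto intro!: powr_mono2)
    also have "\<dots> = (U / 4) powr p" using powr_mult[of "1 / 4" U p] U by simp
    finally have "y - x \<le> U / 4"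
      using xy U p by (smt (verit, best) powr_less_mono2 divide_nonneg_nonneg)
    then show ?thesis using False by argo
  qed
qed

section \<open>The moment as a function of the starting state\<close>

context ergodic_functional
begin

lemma law_S_powr_integrable:
  assumes \<xi>: "\<xi> \<in> space (prob_algebra M)" and p: "0 \<le> p"
  shows "integrable (law \<xi>) (\<lambda>\<omega>. \<bar>s + S n \<omega>\<bar> powr p)"
proof (rule law_integrable[OF \<xi>])
  note [measurable] = law_S_measurable[OF \<xi>]
  show "(\<lambda>\<omega>. \<bar>s + S n \<omega>\<bar> powr p) \<in> borel_measurable (law \<xi>)" by measurable
  fix \<omega> assume "\<omega> \<in> space (law \<xi>)"
  then have "\<bar>s + S n \<omega>\<bar> \<le> \<bar>s\<bar> + real n * c" using S_bound[OF \<xi>, of \<omega> n] by linarith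
  then show "\<bar>\<bar>s + S n \<omega>\<bar> powr p\<bar> \<le> (\<bar>s\<bar> + real n * c) powr p" using p by (auto intro!: powr_mono2)
qed

context
  fixes p :: real assumes p: "1 \<le> p"
begin

text \<open>A function of the sum alone, written with a state argument so that
  \<open>step_op\<close> applies to it.\<close>

abbreviation pow :: "'a \<Rightarrow> real \<Rightarrow> ennreal" where "pow x s \<equiv> ennreal (\<bar>s\<bar> powr p)"

text \<open>The offset \<open>s\<close> is there for the Markov property, which restarts the chain
  with a sum already accumulated.\<close>

definition V :: "nat \<Rightarrow> 'a \<Rightarrow> real \<Rightarrow> real" where
  "V n x s = moment_root (law_from x) p (\<lambda>\<omega>. s + S n \<omega>)"

lemma pow_meas: "(\<lambda>(x, s). pow x s) \<in> borel_measurable (M \<Otimes>\<^sub>M borel)"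
  unfolding split_beta' by measurable

lemma V_powr: "V n x s powr p = (\<integral>\<omega>. \<bar>s + S n \<omega>\<bar> powr p \<partial>law_from x)"
  unfolding V_def using p by (intro moment_root_powr) simp

lemma ennreal_V_powr:
  assumes x: "x \<in> space M"
  shows "ennreal (V n x s powr p) = (\<integral>\<^sup>+\<omega>. pow (\<omega> n) (s + S n \<omega>) \<partial>law_from x)"
  unfolding V_powr using p
  by (intro nn_integral_eq_integral[symmetric] law_S_powr_integrable[OF return_in[OF x]]) auto

text \<open>Joint measurability in state and offset is known for powers of \<open>step_op\<close>;
  this form hands it to \<open>V\<close>.\<close>

lemma V_step_op:
  assumes x: "x \<in> space M"
  shows "V n x s = enn2real ((step_op ^^ n) pow x s) powr (1 / p)"
proof -
  have "(step_op ^^ n) pow x s = ennreal (V n x s powr p)"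
    by (simp add: step_op_pow_eq[OF x pow_meas] ennreal_V_powr[OF x])
  then show ?thesis using p moment_root_nonneg by (simp add: powr_powr V_def)
qed

lemma V_meas: "(\<lambda>(x, s). V n x s) \<in> borel_measurable (M \<Otimes>\<^sub>M borel)"
proof -
  note [measurable] = measurable_step_op_pow[OF pow_meas, of n, unfolded split_beta']
  have "(\<lambda>xs. enn2real ((step_op ^^ n) pow (fst xs) (snd xs)) powr (1 / p)) \<in> borel_measurable (M \<Otimes>\<^sub>M borel)"
    by measurable
  then show ?thesis
    by (rule measurable_cong[THEN iffD1, rotated]) (auto simp: space_pair_measure V_step_op)
qed

lemma V_meas_0: "(\<lambda>x. V n x 0) \<in> borel_measurable M"
  using measurable_compose[OF _ V_meas, of "\<lambda>x. (x, 0)" M n] by simp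

lemma V_nonneg[simp]: "0 \<le> V n x s" by (simp add: V_def moment_root_nonneg)

lemma V_diff:
  assumes x: "x \<in> space M"
  shows "V n x s \<le> \<bar>s - t\<bar> + V n x t"
  unfolding V_def
proof (rule moment_root_le_const_add[OF prob_space_law[OF return_in[OF x]] p])
  note [measurable] = law_S_measurable[OF return_in[OF x]]
  show "(\<lambda>\<omega>. t + S n \<omega>) \<in> borel_measurable (law_from x)" "(\<lambda>\<omega>. s + S n \<omega>) \<in> borel_measurable (law_from x)"
    by measurable
  show "\<bar>t + S n \<omega>\<bar> \<le> \<bar>t\<bar> + real n * c" if "\<omega> \<in> space (law_from x)" for \<omega>
    using S_bound[OF return_in[OF x] that, of n] by linarith
qed auto

lemma V_le:
  assumes x: "x \<in> space M"
  shows "V n x s \<le> \<bar>s\<bar> + real n * c"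
proof -
  interpret prob_space "law_from x" by (rule prob_space_law[OF return_in[OF x]])
  have "V n x s \<le> (\<bar>s\<bar> + real n * c) + moment_root (law_from x) p (\<lambda>_. 0)"
    unfolding V_def
  proof (rule moment_root_le_const_add[OF prob_space_axioms p])
    note [measurable] = law_S_measurable[OF return_in[OF x]]
    show "(\<lambda>\<omega>. s + S n \<omega>) \<in> borel_measurable (law_from x)" by measurable
    show "\<bar>s + S n \<omega>\<bar> \<le> (\<bar>s\<bar> + real n * c) + \<bar>0\<bar>" if "\<omega> \<in> space (law_from x)" for \<omega>
      using S_bound[OF return_in[OF x] that, of n] by linarith
  qed (use c_nonneg in auto)
  then show ?thesis using p by (simp add: moment_root_def)
qed

lemma moment_root_law_eq:
  assumes \<xi>: "\<xi> \<in> space (prob_algebra M)"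
  shows "moment_root (law \<xi>) p (S n) powr p = (\<integral>x. V n x 0 powr p \<partial>\<xi>)"
proof -
  note \<xi>' = prob_algebraD[OF \<xi>]
  note [measurable] = V_meas_0[of n]
  have "ennreal (\<integral>\<omega>. \<bar>S n \<omega>\<bar> powr p \<partial>law \<xi>) = (\<integral>\<^sup>+\<omega>. pow (\<omega> n) (S n \<omega>) \<partial>law \<xi>)"
    using p law_S_powr_integrable[OF \<xi>, of p 0 n] by (intro nn_integral_eq_integral[symmetric]) auto
  also have "\<dots> = (\<integral>\<^sup>+x. ennreal (V n x 0 powr p) \<partial>\<xi>)"
    unfolding nn_integral_initial[OF \<xi> pow_meas]
    using \<xi>' by (intro nn_integral_cong) (simp add: ennreal_V_powr)
  also have "\<dots> = ennreal (\<integral>x. V n x 0 powr p \<partial>\<xi>)"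
  proof (rule nn_integral_eq_integral)
    show "integrable \<xi> (\<lambda>x. V n x 0 powr p)"
      by (rule integrable_prob_algebra_bounded[OF \<xi>, of _ "(real n * c) powr p"])
         (use V_le[of _ n 0] V_nonneg[of n _ 0] p in \<open>auto intro!: powr_mono2\<close>)
  qed simp
  finally have "(\<integral>\<omega>. \<bar>S n \<omega>\<bar> powr p \<partial>law \<xi>) = (\<integral>x. V n x 0 powr p \<partial>\<xi>)"
    by (subst (asm) ennreal_inj) (auto intro: Bochner_Integration.integral_nonneg)
  then show ?thesis using p by (simp add: moment_root_powr)
qed

lemma V_markov:
  assumes z: "z \<in> space M"
  shows "V (m + n) z 0 = moment_root (law_from z) p (\<lambda>\<omega>. V n (\<omega> m) (S m \<omega>))"
proof -
  note r = return_in[OF z]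
  note [measurable] = law_component_measurable[OF r] law_S_measurable[OF r]
    V_meas[of n, unfolded split_beta']
  have Vm: "(\<lambda>\<omega>. V n (\<omega> m) (S m \<omega>)) \<in> borel_measurable (law_from z)"
    using measurable_compose[OF _ V_meas, of "\<lambda>\<omega>. (\<omega> m, S m \<omega>)" "law_from z" n] by simp
  have Vb: "V n (\<omega> m) (S m \<omega>) \<le> real m * c + real n * c" if "\<omega> \<in> space (law_from z)" for \<omega>
    using V_le[OF law_component[OF r that], of n m "S m \<omega>"] S_bound[OF r that, of m] by linarith
  have "ennreal (V (m + n) z 0 powr p) = (\<integral>\<^sup>+\<omega>. pow (\<omega> (m + n)) (S (m + n) \<omega>) \<partial>law_from z)"
    using ennreal_V_powr[OF z, of "m + n" 0] by simp
  also have "\<dots> = (\<integral>\<^sup>+\<omega>. ennreal (V n (\<omega> m) (S m \<omega>) powr p) \<partial>law_from z)"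
    unfolding nn_integral_markov[OF r pow_meas]
    using law_component[OF r] by (intro nn_integral_cong) (simp add: ennreal_V_powr)
  also have "\<dots> = ennreal (\<integral>\<omega>. V n (\<omega> m) (S m \<omega>) powr p \<partial>law_from z)"
  proof (rule nn_integral_eq_integral)
    show "integrable (law_from z) (\<lambda>\<omega>. V n (\<omega> m) (S m \<omega>) powr p)"
      by (rule law_integrable[OF r, of _ "(real m * c + real n * c) powr p"])
         (use Vm Vb V_nonneg p in \<open>auto intro!: powr_mono2\<close>)
  qed simp
  finally have "V (m + n) z 0 powr p = (\<integral>\<omega>. V n (\<omega> m) (S m \<omega>) powr p \<partial>law_from z)"
    by (subst (asm) ennreal_inj) (auto intro: Bochner_Integration.integral_nonneg)
  then have "V (m + n) z 0 powr p = moment_root (law_from z) p (\<lambda>\<omega>. V n (\<omega> m) (S m \<omega>)) powr p"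
    using p V_nonneg by (simp add: moment_root_powr)
  then have "(V (m + n) z 0 powr p) powr (1 / p) =
      (moment_root (law_from z) p (\<lambda>\<omega>. V n (\<omega> m) (S m \<omega>)) powr p) powr (1 / p)" by simp
  then show ?thesis using p V_nonneg moment_root_nonneg by (simp add: powr_powr)
qed

text \<open>Two comparisons, each costing m c. Cutting the last \<open>m\<close> summands passes
  between the horizons \<open>m + n\<close> and \<open>n\<close>. At horizon \<open>m + n\<close>,
  conditioning on time \<open>m\<close> and forgetting the sum collected so far leaves the kernel
  average \<open>q\<close>.\<close>

lemma V_near_shift:
  fixes m n :: nat
  assumes z: "z \<in> space M"
  defines "q \<equiv> P m (\<lambda>x. V n x 0 powr p) z powr (1 / p)"
  shows "V n z 0 \<le> 2 * (real m * c) + q" "q \<le> 2 * (real m * c) + V n z 0"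
proof -
  note r = return_in[OF z] and space_law' = law_component[OF return_in[OF z]]
  note ps = prob_space_law[OF r]
  note [measurable] = law_component_measurable[OF r] law_S_measurable[OF r] V_meas_0[of n]
  have mc: "0 \<le> real m * c" using c_nonneg by simp
  have Vm[measurable]: "(\<lambda>\<omega>. V n (\<omega> m) (S m \<omega>)) \<in> borel_measurable (law_from z)"
    using measurable_compose[OF _ V_meas, of "\<lambda>\<omega>. (\<omega> m, S m \<omega>)" "law_from z" n] by simp
  have Vb: "V n (\<omega> m) (S m \<omega>) \<le> real m * c + real n * c" if "\<omega> \<in> space (law_from z)" for \<omega>
    using V_le[OF space_law'[OF that], of n m "S m \<omega>"] S_bound[OF r that, of m] by linarith
  have "P m (\<lambda>x. V n x 0 powr p) z = (\<integral>\<omega>. V n (\<omega> m) 0 powr p \<partial>law_from z)"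
    by (rule integral_law_from_component[OF z, symmetric, of _ "(real n * c) powr p"])
       (use V_le[of _ n 0] V_nonneg[of n _ 0] p in \<open>auto intro!: powr_mono2\<close>)
  then have q: "q = moment_root (law_from z) p (\<lambda>\<omega>. V n (\<omega> m) 0)"
    by (simp add: q_def moment_root_def V_nonneg)
  have 1: "V n z 0 \<le> real m * c + V (m + n) z 0" "V (m + n) z 0 \<le> real m * c + V n z 0"
  proof -
    have d: "\<bar>S (m + n) \<omega> - S n \<omega>\<bar> \<le> real m * c" if "\<omega> \<in> space (law_from z)" for \<omega>
      using S_diff_bound[OF r that, of n m] by (simp add: add.commute)
    show "V n z 0 \<le> real m * c + V (m + n) z 0" unfolding V_def
    proof (rule moment_root_le_const_add[OF ps p mc])
      show "\<bar>0 + S (m + n) \<omega>\<bar> \<le> real (m + n) * c" if "\<omega> \<in> space (law_from z)" for \<omega>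
        using S_bound[OF r that, of "m + n"] by simp
      show "\<bar>0 + S n \<omega>\<bar> \<le> real m * c + \<bar>0 + S (m + n) \<omega>\<bar>" if "\<omega> \<in> space (law_from z)" for \<omega>
        using d[OF that] by linarith
    qed measurable
    show "V (m + n) z 0 \<le> real m * c + V n z 0" unfolding V_def
    proof (rule moment_root_le_const_add[OF ps p mc])
      show "\<bar>0 + S n \<omega>\<bar> \<le> real n * c" if "\<omega> \<in> space (law_from z)" for \<omega>
        using S_bound[OF r that, of n] by simp
      show "\<bar>0 + S (m + n) \<omega>\<bar> \<le> real m * c + \<bar>0 + S n \<omega>\<bar>" if "\<omega> \<in> space (law_from z)" for \<omega>
        using d[OF that] by linarith
    qed measurable
  qed
  have 2: "V (m + n) z 0 \<le> real m * c + q" "q \<le> real m * c + V (m + n) z 0"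
  proof -
    show "V (m + n) z 0 \<le> real m * c + q" unfolding q V_markov[OF z]
    proof (rule moment_root_le_const_add[OF ps p mc])
      show "\<bar>V n (\<omega> m) 0\<bar> \<le> real n * c" if "\<omega> \<in> space (law_from z)" for \<omega>
        using V_le[OF space_law'[OF that], of n m 0] V_nonneg by simp
      show "\<bar>V n (\<omega> m) (S m \<omega>)\<bar> \<le> real m * c + \<bar>V n (\<omega> m) 0\<bar>" if "\<omega> \<in> space (law_from z)" for \<omega>
        using V_diff[OF space_law'[OF that], of n m "S m \<omega>" 0] S_bound[OF r that, of m] V_nonneg by simp
    qed measurable
    show "q \<le> real m * c + V (m + n) z 0" unfolding q V_markov[OF z]
    proof (rule moment_root_le_const_add[OF ps p mc])
      show "\<bar>V n (\<omega> m) (S m \<omega>)\<bar> \<le> real m * c + real n * c" if "\<omega> \<in> space (law_from z)" for \<omega>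
        using Vb[OF that] V_nonneg by simp
      show "\<bar>V n (\<omega> m) 0\<bar> \<le> real m * c + \<bar>V n (\<omega> m) (S m \<omega>)\<bar>" if "\<omega> \<in> space (law_from z)" for \<omega>
        using V_diff[OF space_law'[OF that], of n m 0 "S m \<omega>"] S_bound[OF r that, of m] V_nonneg by simp
    qed measurable
  qed
  show "V n z 0 \<le> 2 * (real m * c) + q" "q \<le> 2 * (real m * c) + V n z 0"
    using 1 2 by linarith+
qed

end

end

context ergodic_functional
begin

text \<open>If \<open>V\<close> at offset 0 ranges in [L, U], mixing lets the averages of its p-th
  power over m = k \<tau> steps vary by at most 2 * 4^(-k) (U^p - L^p), and
  \<open>powr_contraction\<close> turns this into (U - L)/2 for the roots. With
  \<open>V_near_shift\<close>, U - L \<le> 4 m c + (U - L)/2.\<close>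

lemma V_oscillation:
  assumes p: "1 \<le> p" and k: "2 * (1 / 4) ^ k \<le> (1 / 4) powr p"
    and z: "z \<in> space M" and z': "z' \<in> space M"
  shows "V p n z 0 \<le> V p n z' 0 + 8 * (real (k * \<tau>) * c)"
proof -
  let ?w = "\<lambda>x. V p n x 0" and ?m = "k * \<tau>"
  define U where "U = (SUP x\<in>space M. ?w x)"
  define L where "L = (INF x\<in>space M. ?w x)"
  note [measurable] = V_meas_0[OF p, of n]
  have ne: "space M \<noteq> {}" using z by auto
  have nonneg: "0 \<le> ?w x" for x using V_nonneg[OF p] .
  have le: "?w x \<le> real n * c" if "x \<in> space M" for x using V_le[OF p that, of n 0] by simp
  have bdd: "bdd_above (?w ` space M)" "bdd_below (?w ` space M)"
    using le nonneg by (auto intro!: bdd_aboveI2 bdd_belowI2)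
  have wU: "?w x \<le> U" and Lw: "L \<le> ?w x" if "x \<in> space M" for x
    using that bdd by (auto simp: U_def L_def intro: cSUP_upper cINF_lower)
  have L0: "0 \<le> L" unfolding L_def using ne nonneg by (intro cINF_greatest)
  have LU: "L \<le> U" using wU[OF z] Lw[OF z] by linarith
  define q where "q x = P ?m (\<lambda>x. ?w x powr p) x" for x
  have wp: "L powr p \<le> ?w x powr p" "?w x powr p \<le> U powr p" if "x \<in> space M" for x
    using wU[OF that] Lw[OF that] L0 nonneg p by (auto intro!: powr_mono2)
  have qmix: "\<bar>q x - (\<integral>x. ?w x powr p \<partial>\<pi>)\<bar> \<le> (U powr p - L powr p) * (1 / 4) ^ k" if "x \<in> space M" for x
  proof -
    have "?m div \<tau> = k" using \<tau> by simp
    then show ?thesis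
      using P_mixing[of "\<lambda>x. ?w x powr p" "L powr p" "U powr p" x ?m] wp that by (simp add: q_def)
  qed
  have qL: "L \<le> q x powr (1 / p)" and qU: "q x powr (1 / p) \<le> U" and q0: "0 \<le> q x" if x: "x \<in> space M" for x
  proof -
    have "L powr p \<le> q x" "q x \<le> U powr p"
      unfolding q_def kernel_op_def
      by (rule integral_prob_algebra_bounds[OF kernel_pow_in[OF x] _ wp]; measurable)+
    moreover from this show "0 \<le> q x" using powr_ge_zero[of L p] by linarith
    ultimately have "(L powr p) powr (1 / p) \<le> q x powr (1 / p)" "q x powr (1 / p) \<le> (U powr p) powr (1 / p)"
      using p by (auto intro!: powr_mono2)
    then show "L \<le> q x powr (1 / p)" "q x powr (1 / p) \<le> U" using p L0 LU by (simp_all add: powr_powr)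
  qed
  have osc: "?w x \<le> ?w y + (4 * (real ?m * c) + (U - L) / 2)" if x: "x \<in> space M" and y: "y \<in> space M" for x y
  proof -
    have "q x \<le> q y + 2 * (1 / 4) ^ k * (U powr p - L powr p)"
      using qmix[OF x] qmix[OF y] by (simp add: algebra_simps)
    then have "q x powr (1 / p) \<le> q y powr (1 / p) + (U - L) / 2"
      using p k q0[OF x] q0[OF y]
      by (intro powr_contraction[OF p L0 LU qL[OF y] qU[OF x], of "2 * (1 / 4) ^ k"]) (auto simp: powr_powr)
    then show ?thesis
      using V_near_shift(1)[OF p x, of n ?m] V_near_shift(2)[OF p y, of ?m n] unfolding q_def by linarith
  qed
  \<comment> \<open>Supremum over one state, then infimum over the other, puts U - L on both sides.
    It is finite, as \<open>?w\<close> is bounded by n c, so half of it can be absorbed.\<close>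
  have "U \<le> ?w y + (4 * (real ?m * c) + (U - L) / 2)" if "y \<in> space M" for y
    using osc[OF _ that] ne by (subst (1) U_def) (rule cSUP_least)
  then have "U - (4 * (real ?m * c) + (U - L) / 2) \<le> ?w y" if "y \<in> space M" for y
    using that by (simp add: algebra_simps)
  then have "U - (4 * (real ?m * c) + (U - L) / 2) \<le> L"
    using ne by (subst (2) L_def) (rule cINF_greatest)
  then have "U - L \<le> 8 * (real ?m * c)" by argo
  then show ?thesis using wU[OF z] Lw[OF z'] by linarith
qed

lemma moment_initial_comparison:
  assumes p: "2 \<le> p" and \<xi>: "\<xi> \<in> space (prob_algebra M)"
  shows "moment_root (law \<xi>) p (S n) \<le> moment_root (law \<pi>) p (S n) + 16 * p * real \<tau> * c"
proof -
  have p1: "1 \<le> p" using p by simp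
  \<comment> \<open>k \<ge> p + 1 gives 2 * 4^(-k) \<le> 4^(-p). The upper bound k \<le> p + 2 \<le>
    2 p uses p \<ge> 2 and turns 8 k \<tau> c into at most 16 p \<tau> c.\<close>
  define k where "k = nat \<lceil>p\<rceil> + 1"
  have "real k = real_of_int \<lceil>p\<rceil> + 1" using p by (simp add: k_def)
  then have kp: "p + 1 \<le> real k" "real k \<le> 2 * p"
    using p of_int_ceiling_le_add_one[of p] le_of_int_ceiling[of p] by linarith+
  have "2 * (1 / 4) ^ k = 2 * (1 / 4) powr real k" by (simp add: powr_realpow)
  also have "\<dots> \<le> 2 * (1 / 4) powr (p + 1)" using kp by (intro mult_left_mono powr_mono') auto
  also have "\<dots> \<le> (1 / 4) powr p" by (simp add: powr_add)
  finally have k: "2 * (1 / 4) ^ k \<le> (1 / 4) powr p" .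
  define d where "d = 16 * p * real \<tau> * c"
  have d0: "0 \<le> d" using p c_nonneg by (simp add: d_def)
  have "8 * (real (k * \<tau>) * c) \<le> d"
    using mult_right_mono[OF kp(2), of "8 * real \<tau> * c"] c_nonneg by (simp add: d_def algebra_simps)
  then have osc: "V p n x 0 \<le> V p n y 0 + d" if "x \<in> space M" "y \<in> space M" for x y
    using V_oscillation[OF p1 k that, of n] by linarith
  define R where "R = moment_root (law \<xi>) p (S n)"
  note [measurable] = V_meas_0[OF p1, of n]
  have nonneg: "0 \<le> V p n x 0" for x using V_nonneg[OF p1] .
  have Vb: "V p n x 0 powr p \<le> (real n * c) powr p" if "x \<in> space M" for x
    using V_le[OF p1 that, of n 0] nonneg p by (auto intro!: powr_mono2)
  have root: "(moment_root (law \<mu>) p (S n) powr p) powr (1 / p) = moment_root (law \<mu>) p (S n)" for \<mu>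
    using p by (simp add: powr_powr)
  \<comment> \<open>The oscillation bound is averaged over \<xi> with \<open>y\<close> fixed; the
    resulting lower bound, uniform in \<open>y\<close>, is then averaged over \<pi>.\<close>
  have "R - d \<le> V p n y 0" if y: "y \<in> space M" for y
  proof -
    have "V p n x 0 powr p \<le> (V p n y 0 + d) powr p" if "x \<in> space M" for x
      using osc[OF that y] nonneg p by (auto intro!: powr_mono2)
    from integral_prob_algebra_bounds(2)[OF \<xi> _ _ this, where a = 0]
    have "R powr p \<le> (V p n y 0 + d) powr p"
      unfolding R_def moment_root_law_eq[OF p1 \<xi>] by simp
    from powr_mono2[OF _ powr_ge_zero this, of "1 / p"]
    have "(R powr p) powr (1 / p) \<le> ((V p n y 0 + d) powr p) powr (1 / p)" using p by simp
    then show ?thesis using root[of \<xi>] p nonneg[of y] d0 by (simp add: R_def powr_powr)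
  qed
  \<comment> \<open>Taking p-th powers preserves the lower bound only for positive \<open>a\<close>;
    otherwise the moment being nonnegative suffices.\<close>
  moreover have "moment_root (law \<pi>) p (S n) \<ge> a" if a: "\<And>y. y \<in> space M \<Longrightarrow> a \<le> V p n y 0" for a
  proof (cases "a \<le> 0")
    case False
    then have "a powr p \<le> V p n y 0 powr p" if "y \<in> space M" for y
      using a[OF that] p by (auto intro!: powr_mono2)
    from integral_prob_algebra_bounds(1)[OF \<pi>_in _ this Vb]
    have "a powr p \<le> moment_root (law \<pi>) p (S n) powr p"
      unfolding moment_root_law_eq[OF p1 \<pi>_in] by simp
    from powr_mono2[OF _ powr_ge_zero this, of "1 / p"]
    have "(a powr p) powr (1 / p) \<le> (moment_root (law \<pi>) p (S n) powr p) powr (1 / p)" using p by simp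
    then show ?thesis using root[of \<pi>] p False by (simp add: powr_powr)
  qed (use moment_root_nonneg[of "law \<pi>" p "S n"] in linarith)
  ultimately have "R - d \<le> moment_root (law \<pi>) p (S n)" by blast
  then show ?thesis by (simp add: R_def d_def)
qed

end

section \<open>Constants and conclusion\<close>

lemma C1_ge: "120 \<le> C1"
  using exp_ge_add_one_self[of 1] by (simp add: C1_def)

lemma D1_ge: "1280 \<le> D1"
proof -
  have "2 \<le> sqrt (19 / 3)" by (rule real_le_rsqrt) simp
  then have "16 / 3 * 2 * 120 \<le> 16 / 3 * sqrt (19 / 3) * C1"
    using C1_ge by (intro mult_mono) auto
  then show ?thesis by (simp add: D1_def)
qed

lemma D2_ge: "1280 \<le> D2"
proof -
  have "1 \<le> sqrt C2" by (simp add: C2_def)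
  moreover have "120\<^sup>2 \<le> C1\<^sup>2" using C1_ge by (intro power_mono) auto
  ultimately have "1 * 120\<^sup>2 \<le> sqrt C2 * C1\<^sup>2" by (intro mult_mono) auto
  then have "14400 \<le> sqrt C2 * C1\<^sup>2" by simp
  moreover have "0 \<le> C2" by (simp add: C2_def)
  ultimately show ?thesis unfolding D2_def by argo
qed

text \<open>The mean is bounded by the supremum norm too, so centring at most doubles the bound.
  Boundedness of \<open>f\<close> makes that supremum an actual upper bound.\<close>

lemma ergodic_functional_centered:
  assumes Q: "markov_kernel M Q" and uge: "UGE M Q \<pi> \<tau>" and f: "f \<in> borel_measurable M"
    and bd: "bounded (f ` space M)"
  shows "ergodic_functional M Q (centered \<pi> f) (2 * sup_norm M f) \<pi> \<tau>"
proof -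
  have \<pi>: "\<pi> \<in> space (prob_algebra M)" and inv: "\<pi> \<bind> Q = \<pi>" and \<tau>: "1 \<le> \<tau>"
    and tv: "\<And>n z. z \<in> space M \<Longrightarrow>
      1 / 2 * tv_norm M (\<lambda>A. measure (kernel_pow M Q n z) A - measure \<pi> A) \<le> ennreal ((1 / 4) ^ (n div \<tau>))"
    using uge by (auto simp: UGE_def invariant_distribution_def)
  interpret \<pi>: prob_space \<pi> using prob_algebraD[OF \<pi>] by simp
  obtain K where K: "\<And>z. z \<in> space M \<Longrightarrow> \<bar>f z\<bar> \<le> K" using bd by (auto simp: bounded_iff)
  then have bdd: "bdd_above ((\<lambda>z. \<bar>f z\<bar>) ` space M)" by (intro bdd_aboveI2)
  have fB: "\<bar>f z\<bar> \<le> sup_norm M f" if "z \<in> space M" for z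
    unfolding sup_norm_def using that bdd by (rule cSUP_upper)
  have iB: "\<bar>\<integral>y. f y \<partial>\<pi>\<bar> \<le> sup_norm M f" by (rule integral_prob_algebra_abs_le[OF \<pi> f fB])
  have if': "integrable \<pi> f" by (rule integrable_prob_algebra_bounded[OF \<pi> f fB])
  show ?thesis
  proof (unfold_locales)
    show "centered \<pi> f \<in> borel_measurable M" unfolding centered_def[abs_def] using f by measurable
    show "\<bar>centered \<pi> f z\<bar> \<le> 2 * sup_norm M f" if "z \<in> space M" for z
      using fB[OF that] iB unfolding centered_def by linarith
    show "0 \<le> 2 * sup_norm M f" using iB by linarith
    show "(\<integral>z. centered \<pi> f z \<partial>\<pi>) = 0"
      unfolding centered_def using if' by (simp add: \<pi>.prob_space)
    show "\<bar>measure (kernel_pow M Q n z) A - measure \<pi> A\<bar> \<le> (1 / 4) ^ (n div \<tau>)"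
      if "z \<in> space M" "A \<in> sets M" for n z A
      using that tv \<pi> measurable_space[OF measurable_kernel_pow[OF Q]]
      by (intro measure_diff_le_half_tv) auto
  qed (fact Q \<pi> inv \<tau>)+
qed

theorem theorem1:
  fixes M :: "'a measure" and Q :: "'a \<Rightarrow> 'a measure" and \<pi> :: "'a measure" and \<tau> :: nat
    and f :: "'a \<Rightarrow> real" and p :: real and n :: nat
  assumes "markov_kernel M Q"
    and "UGE M Q \<pi> \<tau>"
    and "f \<in> borel_measurable M"
    and "bounded (f ` space M)"
    and "p \<ge> 2"
    and "n \<ge> 1"
  shows "(moment_root (chain_law M Q \<pi>) p (partial_sum \<pi> f n)
           \<le> C1 * sqrt 2 * p powr (1 / 2) * real n powr (1 / 2) * sqrt (asym_var M Q \<pi> f)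
             + 2 * D1 * real n powr (1 / 4) * real \<tau> powr (3 / 4) * p * log 2 (2 * p) * sup_norm M f
             + 2 * D2 * real \<tau> * p * log 2 (2 * p) * sup_norm M f) \<and>
         (\<forall>\<xi> \<in> space (prob_algebra M).
           moment_root (chain_law M Q \<xi>) p (partial_sum \<pi> f n)
             \<le> moment_root (chain_law M Q \<pi>) p (partial_sum \<pi> f n)
               + 2 * D2 * real \<tau> * p * log 2 (2 * p) * sup_norm M f)"
proof -
  define B where "B = sup_norm M f"
  interpret ergodic_functional M Q "centered \<pi> f" "2 * B" \<pi> \<tau>
    unfolding B_def by (rule ergodic_functional_centered[OF assms(1-4)])
  note p = \<open>p \<ge> 2\<close>
  have B: "0 \<le> B" using c_nonneg by simp
  have S: "partial_sum \<pi> f n = S n" by (simp add: fun_eq_iff partial_sum_def S_def centered_def)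
  have av: "asym_var M Q \<pi> f = var" by (simp add: asym_var_def var_def)
  have lg: "1 \<le> log 2 (2 * p)"
    using p by (subst le_log_iff) auto
  \<comment> \<open>The bounds proved above carry \<open>p\<close> without a logarithm;
    \<open>X\<close> inserts the factor \<open>log 2 (2 * p)\<close>, which is at least 1.\<close>
  define X where "X = p * log 2 (2 * p) * B"
  have X: "p * B \<le> X"
    using mult_right_mono[OF lg, of "p * B"] p B by (simp add: X_def algebra_simps)
  have pB: "0 \<le> p * B" using p B by simp
  define N where "N = real n powr (1 / 4) * real \<tau> powr (3 / 4)"
  have N: "0 \<le> N" by (simp add: N_def)
  let ?s = "sqrt p * sqrt (real n) * sqrt var"
  have s: "0 \<le> ?s" using p var_nonneg by simp
  have "moment_root (chain_law M Q \<pi>) p (S n) \<le> 27 * (?s + 42 * (p * B) * N + 56 * real \<tau> * (p * B))"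
  proof (cases "B = 0")
    \<comment> \<open>\<open>moment_bound\<close> asks for a positive bound on the observable; here
      all partial sums vanish.\<close>
    case True
    have "\<bar>S n \<omega>\<bar> powr p = 0" if "\<omega> \<in> space (law \<pi>)" for \<omega>
      using S_bound[OF \<pi>_in that, of n] True by simp
    then have "(\<integral>\<omega>. \<bar>S n \<omega>\<bar> powr p \<partial>law \<pi>) = (\<integral>\<omega>. 0 \<partial>law \<pi>)"
      by (intro Bochner_Integration.integral_cong) auto
    then have "moment_root (law \<pi>) p (S n) = 0" using p by (simp add: moment_root_def)
    then show ?thesis using s True by simp
  next
    case False
    have "exp (3::real) = exp 1 ^ 3" by (simp flip: exp_of_nat_mult)
    also have "\<dots> \<le> (3::real) ^ 3" using exp_le by (intro power_mono) auto
    finally have "exp 3 \<le> (27::real)" by simp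
    have "moment_root (law \<pi>) p (S n) \<le> exp 3 * (?s + 42 * (p * B) * N + 56 * real \<tau> * (p * B))"
      using moment_bound[OF \<pi>_in p, of n] False B by (simp add: N_def algebra_simps)
    also have "\<dots> \<le> 27 * (?s + 42 * (p * B) * N + 56 * real \<tau> * (p * B))"
      using \<open>exp 3 \<le> 27\<close> s N pB by (intro mult_right_mono add_nonneg_nonneg) auto
    finally show ?thesis .
  qed
  \<comment> \<open>27 bounds \<open>exp 3\<close>; 42 and 56 are twice 21 and 28 because the
    observable is bounded by 2 B. The results 1134 and 1512 are below 2 * 1280, the crude lower
    bound for 2 \<open>D1\<close> and 2 \<open>D2\<close>.\<close>
  also have "\<dots> = 27 * ?s + 1134 * (p * B) * N + 1512 * real \<tau> * (p * B)" by (simp add: algebra_simps)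
  also have "\<dots> \<le> C1 * sqrt 2 * ?s + 2 * D1 * X * N + 2 * D2 * real \<tau> * X"
  proof (intro add_mono mult_right_mono mult_mono)
    have "27 * 1 \<le> C1 * sqrt 2" using C1_ge by (intro mult_mono) auto
    then show "27 \<le> C1 * sqrt 2" by simp
  qed (use D1_ge D2_ge X N s pB in auto)
  also have "\<dots> = C1 * sqrt 2 * p powr (1 / 2) * real n powr (1 / 2) * sqrt var
             + 2 * D1 * real n powr (1 / 4) * real \<tau> powr (3 / 4) * p * log 2 (2 * p) * B
             + 2 * D2 * real \<tau> * p * log 2 (2 * p) * B"
    using p by (simp add: powr_half_sqrt X_def N_def mult_ac)
  finally have 1: "moment_root (chain_law M Q \<pi>) p (S n) \<le> \<dots>" .
  have 2: "moment_root (law \<xi>) p (S n) \<le> moment_root (law \<pi>) p (S n)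
      + 2 * D2 * real \<tau> * p * log 2 (2 * p) * B" if "\<xi> \<in> space (prob_algebra M)" for \<xi>
  proof -
    have "16 * p * real \<tau> * (2 * B) = 32 * real \<tau> * (p * B)" by simp
    also have "\<dots> \<le> 2 * D2 * real \<tau> * X"
      using D2_ge X pB by (intro mult_mono) auto
    finally show ?thesis
      using moment_initial_comparison[OF p that, of n] by (simp add: X_def mult_ac)
  qed
  show ?thesis unfolding S av B_def[symmetric] using 1 2 by blast
qed

end
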